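(* Assume that $\{A_i\}_{i\in E}$ is a commuting family of matrices. If $\bar A$ is Hurwitz, then $\|X_t\|\to 0$ as $t\to\infty$ almost surely.
   Context: Let $E=\{0,1,\dots,n-1\}$ be a finite set and $\{A_i\}_{i\in E}$ a family of real $d\times d$ matrices. A matrix is Hurwitz if all its eigenvalues have strictly negative real part. Let $Q$ be an irreducible generator (rate matrix) on $E$, let $r>0$ be the switching rate, and let $(I_t)_{t\ge 0}$ be the continuous-time (right-continuous jump) Markov process on $E$ with generator $rQ$. Let $\pi$ be the unique probability vector on $E$ with $\pi Q=0$, and set $\bar A=\sum_{i\in E}A_i\pi_i$. Let $(X_t)_{t\ge0}$ be the $\mathbb{R}^d$-valued solution of $X_t=X_0+\int_0^t A_{I_s}X_s\,ds$ for $t\ge 0$, so that $(X_t,I_t)_{t\ge0}$ is a Markov process on $\mathbb{R}^d\times E$. The initial condition $(X_0,I_0)$ has some given law on $\mathbb{R}^d\times E$ with $\mathbb{E}\|X_0\|<\infty$. Here $\|\cdot\|$ is the Euclidean norm. *)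

theory Defs
  imports "HOL-Probability.Probability"
begin

text \<open>Eigenvalues are complex: the real matrix is regarded as a complex one.\<close>

definition complex_eigenvalue :: "real^'d^'d \<Rightarrow> complex \<Rightarrow> bool" where
  "complex_eigenvalue A l \<longleftrightarrow>
     (\<exists>v :: complex^'d. v \<noteq> 0 \<and> map_matrix complex_of_real A *v v = l *s v)"

definition hurwitz :: "real^'d^'d \<Rightarrow> bool" where
  "hurwitz A \<longleftrightarrow> (\<forall>l. complex_eigenvalue A l \<longrightarrow> Re l < 0)"

text \<open>
  The class-based function \<open>exp\<close> does not apply to matrices, since \<open>*\<close> on vectors is
  componentwise.
\<close>

definition mat_exp :: "real^'n^'n \<Rightarrow> real^'n^'n" where
  "mat_exp A = (\<Sum>k. (1 / fact k) *\<^sub>R (((**) A ^^ k) (mat 1)))"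

definition generator_matrix :: "real^'e^'e \<Rightarrow> bool" where
  "generator_matrix Q \<longleftrightarrow>
     (\<forall>i j. i \<noteq> j \<longrightarrow> Q $ i $ j \<ge> 0) \<and> (\<forall>i. (\<Sum>j\<in>UNIV. Q $ i $ j) = 0)"

definition irreducible_generator :: "real^'e^'e \<Rightarrow> bool" where
  "irreducible_generator Q \<longleftrightarrow>
     generator_matrix Q \<and> (\<forall>i j. (i, j) \<in> {(k, l). Q $ k $ l > 0}\<^sup>*)"

definition probability_vector :: "real^'e \<Rightarrow> bool" where
  "probability_vector p \<longleftrightarrow> (\<forall>i. p $ i \<ge> 0) \<and> (\<Sum>i\<in>UNIV. p $ i) = 1"

text \<open>
  Right-continuous with left limits for the discrete topology on the state space. On a finite
  state space this says that the path is right-continuous and piecewise constant, with finitely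
  many jumps in every bounded time interval.
\<close>

definition jump_path :: "(real \<Rightarrow> 'e) \<Rightarrow> bool" where
  "jump_path x \<longleftrightarrow>
     (\<forall>t\<ge>0. \<forall>\<^sub>F s in at_right t. x s = x t) \<and>
     (\<forall>t>0. \<exists>j. \<forall>\<^sub>F s in at_left t. x s = j)"

text \<open>
  Only times \<open>t \<ge> 0\<close> matter. The library's \<open>filtration\<close> is indexed by a whole type; a filtration
  indexed by \<open>t \<ge> 0\<close> is turned into one by setting \<open>F t = F 0\<close> for \<open>t < 0\<close>.
  The initial law is not prescribed.
\<close>

definition markov_jump_process ::
    "'w measure \<Rightarrow> (real \<Rightarrow> 'w measure) \<Rightarrow> real^'e^'e \<Rightarrow> (real \<Rightarrow> 'w \<Rightarrow> 'e) \<Rightarrow> bool" where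
  "markov_jump_process M F G I \<longleftrightarrow>
     filtration (space M) F \<and>
     (\<forall>t\<ge>0. subalgebra M (F t)) \<and>
     (\<forall>t\<ge>0. I t \<in> measurable (F t) (count_space UNIV)) \<and>
     (\<forall>w\<in>space M. jump_path (\<lambda>t. I t w)) \<and>
     (\<forall>s t j. 0 \<le> s \<and> s \<le> t \<longrightarrow>
        (AE w in M. real_cond_exp M (F s) (indicator {w \<in> space M. I t w = j}) w
                    = mat_exp ((t - s) *\<^sub>R G) $ I s w $ j))"

end

theory Submission
  imports Defs "HOL-Computational_Algebra.Fundamental_Theorem_Algebra"
begin

text \<open>
  Since the matrices commute, the switched equation can be integrated explicitly. If \<open>T i t\<close> is the
  time that the path of the chain spends in state \<open>i\<close> up to time \<open>t\<close>, then, path by path,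
  \<open>X t = exp (\<Sum>i. T i t *\<^sub>R A i) (X 0)\<close>: between two jumps both sides solve the same equation with
  constant coefficients, and the factors of the exponential may be reordered freely
  (\<open>solution_eq_exp\<close>). The limit behaviour is therefore governed by the fractions \<open>T i t / t\<close> alone.

  By the ergodic theorem for the chain, \<open>T i t / t\<close> tends to \<open>p $ i\<close> almost surely
  (\<open>ergodic_averages\<close>). Hence the exponent is \<open>t *\<^sub>R Abar\<close> plus a commuting remainder of norm
  \<open>o(t)\<close>, where \<open>Abar\<close> is the averaged matrix. As \<open>Abar\<close> is Hurwitz, \<open>exp (t *\<^sub>R Abar) (X 0)\<close>
  decays like \<open>exp (- c * t)\<close> for some \<open>c > 0\<close> (\<open>hurwitz_exp_decay\<close>), and the remainder costs at most
  \<open>exp (c / 2 * t)\<close> once \<open>t\<close> is large (\<open>solution_tendsto_0\<close>).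

  The ergodic theorem is proved by the martingale method. A function \<open>f\<close> with mean zero under \<open>p\<close> is
  in the range of the generator \<open>G\<close> (\<open>poisson_equation_solvable\<close>), say \<open>f = G *v g\<close>. The process
  \<open>g (I t) - g (I 0) - \<integral>\<^bsub>[0,t]\<^esub> f (I u) du\<close>, observed at integer times, has bounded orthogonal
  increments, so its variance grows at most linearly
  (\<open>dynkin_martingale_second_moment\<close>). Along the times \<open>k\<^sup>2\<close> the second moments of its time averages
  are summable, which gives almost sure convergence there; between consecutive squares the integral
  of a bounded function changes too little to matter.

  Exponentials of matrices are handled in the Banach algebra of endomorphisms of a Euclidean space,
  where the general theory of \<open>exp\<close> applies.
\<close>

section \<open>The Banach algebra of endomorphisms and the matrix exponential\<close>

text \<open>
  A copy of the type of continuous endomorphisms, made into a ring under composition. A separate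
  type is needed because multiplication on a type of vectors or matrices is componentwise, whereas
  \<open>exp\<close> refers to the multiplication of its type class.
\<close>

typedef (overloaded) 'a endo = "UNIV :: ('a::real_normed_vector \<Rightarrow>\<^sub>L 'a) set" ..

setup_lifting type_definition_endo

instantiation endo :: (euclidean_space) real_normed_algebra_1
begin

lift_definition zero_endo :: "'a endo" is 0 .
lift_definition one_endo :: "'a endo" is id_blinfun .
lift_definition plus_endo :: "'a endo \<Rightarrow> 'a endo \<Rightarrow> 'a endo" is "(+)" .
lift_definition minus_endo :: "'a endo \<Rightarrow> 'a endo \<Rightarrow> 'a endo" is "(-)" .
lift_definition uminus_endo :: "'a endo \<Rightarrow> 'a endo" is uminus .
lift_definition times_endo :: "'a endo \<Rightarrow> 'a endo \<Rightarrow> 'a endo" is blinfun_compose .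
lift_definition scaleR_endo :: "real \<Rightarrow> 'a endo \<Rightarrow> 'a endo" is scaleR .
lift_definition norm_endo :: "'a endo \<Rightarrow> real" is norm .

definition dist_endo :: "'a endo \<Rightarrow> 'a endo \<Rightarrow> real" where
  "dist_endo S T = norm (S - T)"
definition sgn_endo :: "'a endo \<Rightarrow> 'a endo" where
  "sgn_endo S = inverse (norm S) *\<^sub>R S"
definition uniformity_endo :: "('a endo \<times> 'a endo) filter" where
  "uniformity_endo = (INF e\<in>{0<..}. principal {(S, T). dist S T < e})"
definition open_endo :: "'a endo set \<Rightarrow> bool" where
  "open_endo U = (\<forall>S\<in>U. \<forall>\<^sub>F (S', T) in uniformity. S' = S \<longrightarrow> T \<in> U)"

instance
proof
  show "norm (1 :: 'a endo) = 1"
    by transfer (rule norm_blinfun_id)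
  show "(0 :: 'a endo) \<noteq> 1"
  proof (transfer, rule notI)
    assume "(0 :: 'a \<Rightarrow>\<^sub>L 'a) = id_blinfun"
    then have "norm (id_blinfun :: 'a \<Rightarrow>\<^sub>L 'a) = 0" by simp
    then show False by simp
  qed
qed (transfer; simp add: dist_endo_def sgn_endo_def uniformity_endo_def open_endo_def
    scaleR_add_left scaleR_add_right norm_triangle_ineq norm_blinfun_compose blinfun_eqI
    blinfun.bilinear_simps; fail
    | simp add: dist_endo_def sgn_endo_def uniformity_endo_def open_endo_def)+

end

instance endo :: (euclidean_space) banach
proof
  fix S :: "nat \<Rightarrow> 'a endo"
  assume "Cauchy S"
  have dist_Rep: "dist (Rep_endo U) (Rep_endo V) = dist U V" for U V :: "'a endo"
    by (simp add: dist_norm norm_endo.rep_eq minus_endo.rep_eq)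
  have "Cauchy (\<lambda>n. Rep_endo (S n))"
    using \<open>Cauchy S\<close> by (simp add: Cauchy_def dist_Rep)
  then obtain L where "(\<lambda>n. Rep_endo (S n)) \<longlonglongrightarrow> L"
    by (meson Cauchy_convergent convergent_def)
  then have "S \<longlonglongrightarrow> Abs_endo L"
    by (simp add: tendsto_iff flip: dist_Rep) (simp add: Abs_endo_inverse)
  then show "convergent S"
    by (rule convergentI)
qed

definition endo_apply :: "'a::euclidean_space endo \<Rightarrow> 'a \<Rightarrow> 'a" where
  "endo_apply S = blinfun_apply (Rep_endo S)"

lemma endo_eqI: "(\<And>x. endo_apply S x = endo_apply T x) \<Longrightarrow> S = T"
  unfolding endo_apply_def by (metis Rep_endo_inject blinfun_eqI)

lemma endo_apply_simps [simp]:
  "endo_apply (S * T) x = endo_apply S (endo_apply T x)"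
  "endo_apply 1 x = x"
  by (simp_all add: endo_apply_def times_endo.rep_eq one_endo.rep_eq)

lemma norm_endo_apply_le: "norm (endo_apply S x) \<le> norm S * norm x"
  by (simp add: endo_apply_def norm_endo.rep_eq norm_blinfun)

lemma bounded_bilinear_endo_apply: "bounded_bilinear endo_apply"
proof
  show "\<exists>K. \<forall>S x. norm (endo_apply S x) \<le> norm S * norm x * K"
    using norm_endo_apply_le by (metis mult.right_neutral)
qed (simp_all add: endo_apply_def plus_endo.rep_eq scaleR_endo.rep_eq blinfun.bilinear_simps)

interpretation endo_apply: bounded_bilinear endo_apply
  by (rule bounded_bilinear_endo_apply)

definition endo_of :: "real^'n^'n \<Rightarrow> (real^'n) endo" where
  "endo_of A = Abs_endo (Blinfun ((*v) A))"

lemma endo_apply_endo_of [simp]: "endo_apply (endo_of A) x = A *v x"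
  by (simp add: endo_apply_def endo_of_def Abs_endo_inverse bounded_linear_Blinfun_apply
      matrix_vector_mul_bounded_linear)

lemma endo_of_mult: "endo_of (A ** B) = endo_of A * endo_of B"
  by (rule endo_eqI) (simp add: matrix_vector_mul_assoc)

lemma endo_of_scaleR: "endo_of (c *\<^sub>R A) = c *\<^sub>R endo_of A"
  by (rule endo_eqI) (simp add: endo_apply.scaleR_left scaleR_matrix_vector_assoc)

lemma endo_of_add: "endo_of (A + B) = endo_of A + endo_of B"
  by (rule endo_eqI) (simp add: endo_apply.add_left matrix_vector_mult_add_rdistrib)

lemma endo_of_zero: "endo_of 0 = 0"
  using endo_of_scaleR[of 0 0] by simp

lemma endo_of_sum: "endo_of (sum A J) = (\<Sum>i\<in>J. endo_of (A i))"
  by (induction J rule: infinite_finite_induct) (simp_all add: endo_of_zero endo_of_add)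

lemma endo_of_power: "endo_of (((**) A ^^ k) (mat 1)) = endo_of A ^ k"
proof (induction k)
  case 0
  show ?case by (rule endo_eqI) simp
qed (simp add: endo_of_mult)

definition mat_of :: "(real^'n) endo \<Rightarrow> real^'n^'n" where
  "mat_of S = matrix (endo_apply S)"

lemma mat_of_entry: "mat_of S $ i $ j = endo_apply S (axis j 1) $ i"
  by (simp add: mat_of_def matrix_def)

lemma mat_of_endo_of: "mat_of (endo_of A) = A"
proof -
  have "endo_apply (endo_of A) = (*v) A" by (rule ext) simp
  then show ?thesis by (simp add: mat_of_def)
qed

lemma mat_of_mult_vec: "mat_of S *v x = endo_apply S x"
  unfolding mat_of_def
  by (rule matrix_works)
    (simp add: linear_matrix_vector_mul_eq bounded_linear.linear[OF endo_apply.bounded_linear_right])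

lemma endo_of_mat_of: "endo_of (mat_of S) = S"
  by (rule endo_eqI) (simp add: mat_of_mult_vec)

lemma mat_of_mult: "mat_of (S * T) = mat_of S ** mat_of T"
  by (metis endo_of_mat_of endo_of_mult mat_of_endo_of)

lemma bounded_linear_mat_of: "bounded_linear (mat_of :: (real^'n) endo \<Rightarrow> real^'n^'n)"
proof (intro bounded_linear_intro[where K = "real CARD('n) * real CARD('n)"])
  fix S T :: "(real^'n) endo" and c :: real
  show "mat_of (S + T) = mat_of S + mat_of T"
    by (simp add: vec_eq_iff mat_of_entry endo_apply.add_left)
  show "mat_of (c *\<^sub>R S) = c *\<^sub>R mat_of S"
    by (simp add: vec_eq_iff mat_of_entry endo_apply.scaleR_left)
  have entry: "\<bar>mat_of S $ i $ j\<bar> \<le> norm S" for i j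
    using component_le_norm_cart[of "endo_apply S (axis j 1)" i]
      norm_endo_apply_le[of S "axis j 1"] by (simp add: mat_of_entry)
  have "norm (mat_of S) \<le> (\<Sum>i\<in>UNIV. norm (mat_of S $ i))"
    unfolding norm_vec_def by (rule L2_set_le_sum) simp
  also have "\<dots> \<le> (\<Sum>i\<in>(UNIV::'n set). \<Sum>j\<in>(UNIV::'n set). norm S)"
    by (intro sum_mono order_trans[OF norm_le_l1_cart] entry)
  finally show "norm (mat_of S) \<le> norm S * (real CARD('n) * real CARD('n))"
    by (simp add: mult_ac)
qed

text \<open>
  Through this identity every fact about \<open>exp\<close> in a Banach algebra becomes one about \<open>mat_exp\<close>;
  it holds because \<open>mat_of\<close> is continuous and can be applied to the series term by term.
\<close>

lemma mat_exp_eq: "mat_exp A = mat_of (exp (endo_of A))"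
proof -
  have "(\<lambda>k. endo_of A ^ k /\<^sub>R fact k) sums exp (endo_of A)"
    by (rule exp_converges)
  from bounded_linear.sums[OF bounded_linear_mat_of this]
  have "(\<lambda>k. mat_of (endo_of A ^ k /\<^sub>R fact k)) sums mat_of (exp (endo_of A))" .
  also have "(\<lambda>k. mat_of (endo_of A ^ k /\<^sub>R fact k))
    = (\<lambda>k. (1 / fact k) *\<^sub>R (((**) A ^^ k) (mat 1)))"
    by (simp add: linear_cmul[OF bounded_linear.linear[OF bounded_linear_mat_of]]
        mat_of_endo_of inverse_eq_divide flip: endo_of_power)
  finally show ?thesis
    unfolding mat_exp_def by (rule sums_unique[symmetric])
qed

lemma mat_exp_has_vector_derivative:
  "((\<lambda>t. mat_exp (t *\<^sub>R G)) has_vector_derivative (mat_exp (t *\<^sub>R G) ** G)) (at t within T)"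
proof -
  have "((\<lambda>t. exp (t *\<^sub>R endo_of G)) has_vector_derivative exp (t *\<^sub>R endo_of G) * endo_of G)
    (at t within T)"
    by (rule exp_scaleR_has_vector_derivative_right)
  from bounded_linear.has_vector_derivative[OF bounded_linear_mat_of this]
  show ?thesis
    by (simp add: mat_exp_eq endo_of_scaleR mat_of_mult mat_of_endo_of)
qed

section \<open>Exponential decay for Hurwitz matrices\<close>

definition cmat :: "real^'n^'n \<Rightarrow> complex^'n^'n" where
  "cmat = map_matrix complex_of_real"

lemma cmat_mult: "cmat (A ** B) = cmat A ** cmat B"
  by (simp add: cmat_def map_matrix_def matrix_matrix_mult_def vec_eq_iff)

lemma cmat_one: "cmat (mat 1) = mat 1"
  by (simp add: cmat_def map_matrix_def mat_def vec_eq_iff)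

text \<open>
  A linear scalar equation that is stable, with an exponentially small forcing term, has
  exponentially small solutions. The rate \<open>c'\<close> stays strictly below \<open>- Re l\<close>, since a forcing term
  that decays exactly at rate \<open>- Re l\<close> can cause resonance and an additional factor \<open>t\<close>.
\<close>

lemma perturbed_scalar_decay:
  fixes u w :: "real \<Rightarrow> complex" and l :: complex
  assumes u: "\<And>t. (u has_vector_derivative l * u t + w t) (at t)"
    and w: "\<And>t. t \<ge> 0 \<Longrightarrow> cmod (w t) \<le> C * exp (- (c * t))"
    and "0 \<le> C" "0 < a" "a = - Re l - c'" "c' \<le> c" "0 \<le> t"
  shows "cmod (u t) \<le> (cmod (u 0) + C / a) * exp (- (c' * t))"
proof (cases "t = 0")
  case True
  then show ?thesis using assms by simp
next
  case False
  \<comment> \<open>variation of constants\<close>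
  define z where "z = (\<lambda>t. exp (t *\<^sub>R (- l)) * u t)"
  have dz: "(z has_vector_derivative exp (s *\<^sub>R (- l)) * w s) (at s)" for s
  proof -
    have "(z has_vector_derivative
        exp (s *\<^sub>R (- l)) * (l * u s + w s) + exp (s *\<^sub>R (- l)) * (- l) * u s) (at s)"
      unfolding z_def
      by (intro has_vector_derivative_mult u exp_scaleR_has_vector_derivative_right)
    then show ?thesis by (simp add: algebra_simps)
  qed
  have dphi: "((\<lambda>s. C / a * exp (a * s)) has_vector_derivative C * exp (a * s)) (at s)" for s
    using \<open>0 < a\<close> by (auto intro!: derivative_eq_intros
        simp flip: has_real_derivative_iff_has_vector_derivative)
  have "cmod (z t - z 0) \<le> C / a * exp (a * t) - C / a * exp (a * 0)"
  proof (rule differentiable_bound_general)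
    show "0 < t" using False \<open>0 \<le> t\<close> by simp
    show "continuous_on {0..t} z" "continuous_on {0..t} (\<lambda>s. C / a * exp (a * s))"
      by (rule continuous_on_vector_derivative[OF has_vector_derivative_at_within], rule dz)
        (rule continuous_on_vector_derivative[OF has_vector_derivative_at_within], rule dphi)
    fix s :: real
    assume "0 < s" "s < t"
    have "cmod (exp (s *\<^sub>R (- l)) * w s) \<le> exp (- (s * Re l)) * (C * exp (- (c * s)))"
      using w[of s] \<open>0 < s\<close> by (simp add: norm_mult)
    also have "\<dots> = C * exp (- (s * Re l) - c * s)"
      by (simp add: exp_diff exp_minus field_simps)
    also have "\<dots> \<le> C * exp (a * s)"
    proof -
      have "s * (- Re l - c) \<le> s * a"
        using \<open>0 < s\<close> \<open>c' \<le> c\<close> \<open>a = _\<close> by (intro mult_left_mono) simp_all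
      then show ?thesis
        using \<open>0 \<le> C\<close> by (intro mult_left_mono) (simp_all add: algebra_simps)
    qed
    finally show "cmod (exp (s *\<^sub>R (- l)) * w s) \<le> C * exp (a * s)" .
  qed (rule dz dphi)+
  moreover have "0 \<le> C / a" using assms by simp
  ultimately have "cmod (z t - z 0) \<le> C / a * exp (a * t)"
    by simp
  then have "cmod (z t) \<le> cmod (u 0) + C / a * exp (a * t)"
    using norm_triangle_ineq2[of "z t" "z 0"] by (simp add: z_def)
  moreover have "u t = exp (t *\<^sub>R l) * z t"
    by (simp add: z_def exp_minus)
  ultimately have "cmod (u t) \<le> exp (t * Re l) * (cmod (u 0) + C / a * exp (a * t))"
    by (simp add: norm_mult)
  also have "\<dots> = exp (t * Re l) * cmod (u 0) + C / a * exp (- (c' * t))"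
  proof -
    have "exp (t * Re l) * exp (a * t) = exp (- (c' * t))"
      unfolding \<open>a = _\<close> by (simp add: algebra_simps flip: exp_add)
    then have "C / a * (exp (t * Re l) * exp (a * t)) = C / a * exp (- (c' * t))" by simp
    then show ?thesis by (simp add: distrib_left mult_ac)
  qed
  also have "\<dots> \<le> exp (- (c' * t)) * cmod (u 0) + C / a * exp (- (c' * t))"
  proof -
    have "Re l \<le> - c'" using \<open>0 < a\<close> \<open>a = _\<close> by simp
    then have "t * Re l \<le> - (c' * t)"
      using mult_left_mono[of "Re l" "- c'" t] \<open>0 \<le> t\<close> by (simp add: mult_ac)
    then show ?thesis by (intro add_right_mono mult_right_mono) simp_all
  qed
  finally show ?thesis by (simp add: algebra_simps)
qed

definition cexp :: "real^'n^'n \<Rightarrow> real \<Rightarrow> complex^'n^'n" where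
  "cexp A t = cmat (mat_exp (t *\<^sub>R A))"

lemma cexp_0: "cexp A 0 = mat 1"
proof -
  have "mat_exp (0 *\<^sub>R A) = mat_of 1"
    by (simp add: mat_exp_eq endo_of_zero)
  also have "\<dots> = mat 1"
    by (simp add: mat_of_entry vec_eq_iff mat_def axis_def)
  finally show ?thesis by (simp add: cexp_def cmat_one)
qed

lemma cexp_has_vector_derivative:
  "((\<lambda>t. (cexp A t *v v) $ k) has_vector_derivative (cexp A t *v (cmat A *v v)) $ k) (at t)"
proof -
  have "linear (\<lambda>M. (cmat M *v v) $ k)"
    by (rule linearI)
      (simp_all add: cmat_def map_matrix_def matrix_vector_mult_def algebra_simps
        sum.distrib sum_distrib_left scaleR_conv_of_real[where 'a = complex])
  then have "bounded_linear (\<lambda>M. (cmat M *v v) $ k)"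
    by (simp only: linear_conv_bounded_linear)
  from bounded_linear.has_vector_derivative[OF this mat_exp_has_vector_derivative]
  show ?thesis
    by (simp add: cexp_def cmat_mult matrix_vector_mul_assoc)
qed

text \<open>
  The vectors whose orbit under the flow of \<open>A\<close> decays exponentially. Complex vectors are needed
  because the eigenvectors of \<open>A\<close> may be complex.
\<close>

definition decaying :: "real^'n^'n \<Rightarrow> complex^'n \<Rightarrow> bool" where
  "decaying A v \<longleftrightarrow>
     (\<exists>C c. 0 < c \<and> (\<forall>t\<ge>0. \<forall>k. cmod ((cexp A t *v v) $ k) \<le> C * exp (- (c * t))))"

text \<open>
  If \<open>w = (A - l) v\<close> decays then the orbit \<open>u\<close> of \<open>v\<close> satisfies \<open>u' = l * u + (orbit of w)\<close>, to which
  the scalar lemma applies in each coordinate. Generalized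
  eigenvectors are thereby reached one step at a time.
\<close>

lemma decaying_step:
  assumes "Re l < 0" "decaying A (cmat A *v v - l *s v)"
  shows "decaying A v"
proof -
  obtain C c where "0 < c" and
    bound: "\<And>t k. t \<ge> 0 \<Longrightarrow> cmod ((cexp A t *v (cmat A *v v - l *s v)) $ k) \<le> C * exp (- (c * t))"
    using assms(2) unfolding decaying_def by blast
  have "0 \<le> C"
    using bound[of 0 undefined] order_trans[OF norm_ge_zero] by fastforce
  \<comment> \<open>The rate is at most that of the forcing term and strictly below \<open>- Re l\<close>, so that \<open>a > 0\<close>.\<close>
  define c' where "c' = min c (- Re l / 2)"
  define a where "a = - Re l - c'"
  have "0 < c'" "c' \<le> c" "0 < a"
    using \<open>0 < c\<close> \<open>Re l < 0\<close> by (auto simp: c'_def a_def min_def)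
  have "cmod ((cexp A t *v v) $ k) \<le> (norm v + C / a) * exp (- (c' * t))" if "0 \<le> t" for t k
  proof -
    have "cmod ((cexp A t *v v) $ k)
        \<le> (cmod ((cexp A 0 *v v) $ k) + C / a) * exp (- (c' * t))"
    proof (rule perturbed_scalar_decay[where l = l and w = "\<lambda>t. (cexp A t *v (cmat A *v v - l *s v)) $ k"])
      fix s
      have "(cexp A s *v (cmat A *v v)) $ k
        = l * (cexp A s *v v) $ k + (cexp A s *v (cmat A *v v - l *s v)) $ k"
        by (simp add: matrix_vector_mult_diff_distrib vector_scalar_commute)
      with cexp_has_vector_derivative[of A v k s]
      show "((\<lambda>t. (cexp A t *v v) $ k) has_vector_derivative
          l * (cexp A s *v v) $ k + (cexp A s *v (cmat A *v v - l *s v)) $ k) (at s)"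
        by simp
    qed (use bound \<open>0 \<le> C\<close> \<open>0 < a\<close> \<open>c' \<le> c\<close> \<open>0 \<le> t\<close> a_def in auto)
    also have "\<dots> \<le> (norm v + C / a) * exp (- (c' * t))"
      by (intro mult_right_mono add_right_mono) (simp_all add: cexp_0 Finite_Cartesian_Product.norm_nth_le)
    finally show ?thesis .
  qed
  then show ?thesis
    unfolding decaying_def using \<open>0 < c'\<close> by blast
qed

text \<open>
  This is \<open>q(B) v\<close>, evaluated by Horner's scheme.
\<close>

definition poly_act :: "complex^'n^'n \<Rightarrow> complex poly \<Rightarrow> complex^'n \<Rightarrow> complex^'n" where
  "poly_act B q v = fold_coeffs (\<lambda>a w. a *s v + B *v w) q 0"

lemma poly_act_0 [simp]: "poly_act B 0 v = 0"
  by (simp add: poly_act_def)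

lemma poly_act_pCons [simp]: "poly_act B (pCons a q) v = a *s v + B *v poly_act B q v"
  by (cases "q = 0 \<and> a = 0") (auto simp: poly_act_def)

lemma poly_act_smult: "poly_act B (smult c q) v = c *s poly_act B q v"
  by (induction q) (auto simp: vector_scalar_commute vector_ssub_ldistrib vector_add_ldistrib)

lemma poly_act_add: "poly_act B (p + q) v = poly_act B p v + poly_act B q v"
proof (induction p arbitrary: q)
  case (pCons a p)
  then show ?case
    by (cases q) (simp add: matrix_vector_right_distrib vector_sadd_rdistrib)
qed simp

lemma poly_act_sum: "poly_act B (sum f S) v = (\<Sum>i\<in>S. poly_act B (f i) v)"
  by (induction S rule: infinite_finite_induct) (simp_all add: poly_act_add)

lemma poly_act_monom: "poly_act B (monom c k) v = c *s (((*v) B ^^ k) v)"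
  by (induction k) (simp_all add: monom_0 monom_Suc vector_scalar_commute)

lemma poly_act_vec_diff: "poly_act B q (v - w) = poly_act B q v - poly_act B q w"
  by (induction q) (auto simp: matrix_vector_mult_diff_distrib vector_ssub_ldistrib)

lemma poly_act_vec_scale: "poly_act B q (c *s v) = c *s poly_act B q v"
  by (induction q) (auto simp: vector_scalar_commute vector_add_ldistrib mult_ac)

lemma poly_act_commute: "B *v poly_act B q v = poly_act B q (B *v v)"
  by (induction q) (auto simp: vector_scalar_commute matrix_vector_right_distrib)

lemma poly_act_linear_factor:
  "poly_act B ([:- l, 1:] * q) v = B *v poly_act B q v - l *s poly_act B q v"
proof -
  have "[:- l, 1:] * q = smult (- l) q + pCons 0 q" by simp
  then show ?thesis
    by (simp only: poly_act_add poly_act_smult) simp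
qed

text \<open>
  The iterates \<open>v, B v, B\<^sup>2 v, ...\<close> live in a space of finite dimension, so finitely many of them are
  linearly dependent over the reals. A repetition among the iterates is treated
  apart, because dependence is a property of their set.
\<close>

lemma exists_annihilating_poly: "\<exists>q. q \<noteq> 0 \<and> poly_act B q v = 0"
proof -
  let ?n = "DIM(complex^'a)"
  define K where "K = (\<lambda>k. ((*v) B ^^ k) v)"
  show ?thesis
  proof (cases "inj_on K {..?n}")
    case False
    then obtain i j where "i \<noteq> j" "K i = K j"
      by (auto simp: inj_on_def)
    have "coeff (monom (1::complex) i - monom 1 j) i \<noteq> 0"
      using \<open>i \<noteq> j\<close> by simp
    then have "monom (1::complex) i - monom 1 j \<noteq> 0" by force
    moreover have "poly_act B (monom 1 i + smult (- 1) (monom 1 j)) v = 0"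
      using \<open>K i = K j\<close> by (simp only: poly_act_add poly_act_smult poly_act_monom) (simp add: K_def)
    ultimately show ?thesis by (intro exI[of _ "monom 1 i + smult (- 1) (monom 1 j)"]) simp
  next
    case True
    then have "card (K ` {..?n}) > ?n" by (simp add: card_image)
    then have "dependent (K ` {..?n})"
      by (intro dependent_biggerset) auto
    then obtain u where u: "\<exists>w\<in>K ` {..?n}. u w \<noteq> 0" "(\<Sum>w\<in>K ` {..?n}. u w *\<^sub>R w) = 0"
      by (auto simp: dependent_finite)
    define q where "q = (\<Sum>k\<le>?n. monom (complex_of_real (u (K k))) k)"
    obtain m where m: "m \<le> ?n" "u (K m) \<noteq> 0" using u(1) by auto
    have "coeff q m = complex_of_real (u (K m))"
      using m by (simp add: q_def coeff_sum)
    with m have "q \<noteq> 0" by force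
    moreover have "poly_act B q v = (\<Sum>k\<le>?n. u (K k) *\<^sub>R K k)"
      by (simp add: q_def poly_act_sum poly_act_monom vec_eq_iff K_def
          scaleR_conv_of_real[where 'a = complex])
    with u(2) True have "poly_act B q v = 0"
      by (simp add: sum.reindex)
    ultimately show ?thesis by blast
  qed
qed

text \<open>
  Induction on the degree of an annihilating polynomial, splitting off one linear factor at a time.
  A root with negative real part is absorbed by \<open>decaying_step\<close>; any other root is not an eigenvalue
  and contributes an injective factor, which can be cancelled.
\<close>

lemma hurwitz_decaying:
  assumes A: "hurwitz A"
  shows "q \<noteq> 0 \<Longrightarrow> poly_act (cmat A) q v = 0 \<Longrightarrow> decaying A v"
proof (induction "degree q" arbitrary: q v rule: less_induct)
  case less
  show ?case
  proof (cases "degree q = 0")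
    case True
    then obtain a where "q = [:a:]" by (meson degree_eq_zeroE)
    with less.prems have "v = 0" by simp
    then have "\<forall>t\<ge>0. \<forall>k. cmod ((cexp A t *v v) $ k) \<le> 0 * exp (- (1 * t))" by simp
    then show ?thesis unfolding decaying_def using zero_less_one by blast
  next
    case False
    then have "\<not> constant (poly q)" by (simp add: constant_degree)
    then obtain l where "poly q l = 0" using fundamental_theorem_of_algebra by blast
    then obtain q' where q: "q = [:- l, 1:] * q'" by (auto simp: poly_eq_0_iff_dvd)
    have "q' \<noteq> 0" using q \<open>q \<noteq> 0\<close> by auto
    have "degree q = Suc (degree q')"
      using q \<open>q' \<noteq> 0\<close> by (simp add: degree_mult_eq del: mult_pCons_left)
    then have IH: "poly_act (cmat A) q' x = 0 \<Longrightarrow> decaying A x" for x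
      using less.hyps[of q' x] \<open>q' \<noteq> 0\<close> by simp
    have eq: "cmat A *v poly_act (cmat A) q' v - l *s poly_act (cmat A) q' v = 0"
      using less.prems(2) unfolding q poly_act_linear_factor .
    show ?thesis
    proof (cases "Re l < 0")
      case True
      have "poly_act (cmat A) q' (cmat A *v v - l *s v) = 0"
        using eq by (simp add: poly_act_vec_diff poly_act_vec_scale poly_act_commute)
      then show ?thesis using IH decaying_step True by blast
    next
      case False
      then have "poly_act (cmat A) q' v = 0"
        using A eq unfolding hurwitz_def complex_eigenvalue_def cmat_def by auto
      then show ?thesis by (rule IH)
    qed
  qed
qed

lemma hurwitz_exp_decay:
  assumes "hurwitz A"
  obtains C c where "0 < c"
    "\<And>t. t \<ge> 0 \<Longrightarrow> norm (endo_apply (exp (t *\<^sub>R endo_of A)) x) \<le> C * exp (- (c * t))"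
proof -
  define v where "v = (\<chi> i. complex_of_real (x $ i))"
  have "decaying A v"
    using exists_annihilating_poly hurwitz_decaying[OF assms] by blast
  then obtain C c where "0 < c" and
    bound: "\<And>t k. t \<ge> 0 \<Longrightarrow> cmod ((cexp A t *v v) $ k) \<le> C * exp (- (c * t))"
    unfolding decaying_def by blast
  have "norm (endo_apply (exp (t *\<^sub>R endo_of A)) x) \<le> (real CARD('a) * C) * exp (- (c * t))"
    if "t \<ge> 0" for t
  proof -
    let ?y = "endo_apply (exp (t *\<^sub>R endo_of A)) x"
    have "?y = mat_exp (t *\<^sub>R A) *v x"
      by (simp add: mat_exp_eq mat_of_mult_vec endo_of_scaleR)
    then have "(cexp A t *v v) $ k = complex_of_real (?y $ k)" for k
      by (simp add: cexp_def cmat_def map_matrix_def v_def matrix_vector_mult_def)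
    then have "\<bar>?y $ k\<bar> \<le> C * exp (- (c * t))" for k
      using bound[OF that, of k] by simp
    then have "(\<Sum>k\<in>UNIV. \<bar>?y $ k\<bar>) \<le> (\<Sum>k\<in>(UNIV::'a set). C * exp (- (c * t)))"
      by (intro sum_mono)
    with norm_le_l1_cart[of ?y] show ?thesis by simp
  qed
  with \<open>0 < c\<close> show thesis by (rule that)
qed

section \<open>The Poisson equation of an irreducible generator\<close>

text \<open>
  The maximum principle: at a state where \<open>g\<close> is maximal, \<open>Q *v g = 0\<close> forces \<open>g\<close> to take the same
  value at every state that can be reached in one jump, and irreducibility spreads the maximum to
  all states.
\<close>

lemma irreducible_harmonic_const:
  fixes Q :: "real^'e^'e"
  assumes "irreducible_generator Q" "Q *v g = 0"
  shows "g $ i = g $ j"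
proof -
  have rows: "(\<Sum>j\<in>UNIV. Q $ i $ j) = 0" and off: "i \<noteq> j \<Longrightarrow> 0 \<le> Q $ i $ j" for i j
    using assms(1) by (auto simp: irreducible_generator_def generator_matrix_def)
  define m where "m = Max (range (($) g))"
  have le_m: "g $ k \<le> m" for k by (simp add: m_def)
  obtain k0 where k0: "g $ k0 = m"
    using Max_in[of "range (($) g)"] unfolding m_def by fastforce
  have step: "g $ l = m" if "g $ k = m" "Q $ k $ l > 0" for k l
  proof -
    have "(\<Sum>j\<in>UNIV. Q $ k $ j * (m - g $ j)) = m * (\<Sum>j\<in>UNIV. Q $ k $ j) - (Q *v g) $ k"
      by (simp add: matrix_vector_mult_def right_diff_distrib sum_subtractf sum_distrib_left mult_ac)
    also have "\<dots> = 0" using rows assms(2) by simp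
    finally have "(\<Sum>j\<in>UNIV. Q $ k $ j * (m - g $ j)) = 0" .
    moreover have "0 \<le> Q $ k $ j * (m - g $ j)" for j
      using off[of k j] le_m[of j] that(1) by (cases "k = j") auto
    ultimately have "Q $ k $ l * (m - g $ l) = 0"
      by (simp add: sum_nonneg_eq_0_iff)
    with that(2) show ?thesis by simp
  qed
  have "g $ l = m" for l
  proof -
    have "(k0, l) \<in> {(k, l). Q $ k $ l > 0}\<^sup>*"
      using assms(1) by (auto simp: irreducible_generator_def)
    then show ?thesis
    proof (induction rule: rtrancl_induct)
      case (step k l)
      then show ?case using \<open>\<And>k l. \<lbrakk>g $ k = m; 0 < Q $ k $ l\<rbrakk> \<Longrightarrow> g $ l = m\<close>[of k l] by simp
    qed (rule k0)
  qed
  then show ?thesis by simp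
qed

text \<open>
  Adding to \<open>Q\<close> the map that sends \<open>g\<close> to the constant \<open>p \<bullet> g\<close> gives an injective, hence surjective,
  linear map \<open>L\<close>: applying \<open>p\<close> to \<open>L g = 0\<close> yields \<open>p \<bullet> g = 0\<close>, so \<open>g\<close> is harmonic, thus constant, with
  mean zero. The same computation shows that a preimage of a vector of mean zero has mean zero,
  where \<open>L\<close> and \<open>Q\<close> agree.
\<close>

lemma poisson_equation_solvable:
  fixes Q :: "real^'e^'e"
  assumes Q: "irreducible_generator Q" and p: "probability_vector p" "p v* Q = 0"
    and f: "p \<bullet> f = 0"
  shows "\<exists>g. Q *v g = f"
proof -
  have inner_one: "p \<bullet> (\<chi> i. c) = c" for c
    using p(1) by (simp add: inner_vec_def probability_vector_def flip: sum_distrib_right)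
  have inner_Q: "p \<bullet> (Q *v g) = 0" for g
    using p(2) by (metis dot_lmul_matrix inner_zero_left)
  define L where "L = (\<lambda>g. Q *v g + (\<chi> i. p \<bullet> g))"
  have inner_L: "p \<bullet> L g = p \<bullet> g" for g
    by (simp add: L_def inner_add_right inner_Q inner_one)
  have "linear L"
    unfolding L_def by (rule linearI)
      (simp_all add: vec_eq_iff matrix_vector_right_distrib inner_add_right algebra_simps)
  moreover have "inj L"
  proof (rule injI)
    fix g h
    assume "L g = L h"
    then have 0: "L (g - h) = 0"
      using linear_diff[OF \<open>linear L\<close>] by simp
    then have 1: "p \<bullet> (g - h) = 0" using inner_L[of "g - h"] by simp
    with 0 have "Q *v (g - h) = 0"
      by (simp add: L_def vec_eq_iff)
    from irreducible_harmonic_const[OF Q this]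
    have "g - h = (\<chi> i. (g - h) $ undefined)" by (simp add: vec_eq_iff)
    with inner_one[of "(g - h) $ undefined"] 1 have "(g - h) $ undefined = 0" by simp
    with \<open>g - h = (\<chi> i. (g - h) $ undefined)\<close> have "g - h = 0"
      by (simp add: vec_eq_iff)
    then show "g = h" by simp
  qed
  ultimately have "surj L" by (rule linear_inj_imp_surj)
  then obtain g where g: "f = L g" by (meson surj_def)
  with inner_L[of g] f have "p \<bullet> g = 0" by simp
  with g have "Q *v g = f" by (simp add: L_def vec_eq_iff)
  then show ?thesis ..
qed

section \<open>Joint measurability and almost sure limits\<close>

text \<open>
  Sampling the process at grid points to the right of the current time gives jointly measurable
  processes with countably many pieces, and right continuity makes them converge to \<open>Z\<close>.
\<close>

lemma measurable_pair_right_locally_const: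
  fixes Z :: "real \<Rightarrow> 'w \<Rightarrow> 'e" and f :: "'e \<Rightarrow> real"
  assumes Z: "\<And>u. Z u \<in> measurable N (count_space UNIV)"
    and right: "\<And>u w. w \<in> space N \<Longrightarrow> \<forall>\<^sub>F v in at_right u. Z v w = Z u w"
  shows "(\<lambda>(w, u). f (Z u w)) \<in> borel_measurable (N \<Otimes>\<^sub>M lborel)"
proof (rule borel_measurable_LIMSEQ_real)
  \<comment> \<open>the first multiple of \<open>1 / Suc n\<close> strictly to the right of \<open>u\<close>\<close>
  define grid :: "nat \<Rightarrow> real \<Rightarrow> real" where
    "grid n u = real_of_int (\<lfloor>u * real (Suc n)\<rfloor> + 1) / real (Suc n)" for n u
  show "(\<lambda>(w, u). f (Z (grid n u) w)) \<in> borel_measurable (N \<Otimes>\<^sub>M lborel)" for n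
  proof -
    have "(\<lambda>x. f (Z (real_of_int (\<lfloor>snd x * real (Suc n)\<rfloor> + 1) / real (Suc n)) (fst x)))
        \<in> borel_measurable (N \<Otimes>\<^sub>M lborel)"
    proof (rule measurable_compose_countable[where
          f = "\<lambda>k x. f (Z (real_of_int (k + 1) / real (Suc n)) (fst x))"
          and g = "\<lambda>x. \<lfloor>snd x * real (Suc n)\<rfloor>"])
      show "(\<lambda>x. f (Z (real_of_int (k + 1) / real (Suc n)) (fst x)))
          \<in> borel_measurable (N \<Otimes>\<^sub>M lborel)" for k
        by (rule measurable_compose[OF measurable_fst])
          (rule measurable_compose[OF Z], simp)
    qed measurable
    then show ?thesis by (simp add: grid_def case_prod_beta')
  qed
  fix x :: "'w \<times> real"
  assume "x \<in> space (N \<Otimes>\<^sub>M lborel)"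
  then obtain u w where x: "x = (w, u)" and w: "w \<in> space N"
    by (auto simp: space_pair_measure)
  have "filterlim (\<lambda>n. grid n u) (at_right u) sequentially"
    unfolding filterlim_at
  proof (intro conjI)
    have less: "u < grid n u" and le: "grid n u \<le> u + 1 / real (Suc n)" for n
    proof -
      have "u * real (Suc n) < real_of_int (\<lfloor>u * real (Suc n)\<rfloor> + 1)"
        using floor_less_iff by linarith
      then show "u < grid n u" by (simp add: grid_def pos_less_divide_eq del: of_nat_Suc)
      have "real_of_int (\<lfloor>u * real (Suc n)\<rfloor> + 1) \<le> (u + 1 / real (Suc n)) * real (Suc n)"
        using of_int_floor_le[of "u * real (Suc n)"] by (simp add: distrib_right del: of_nat_Suc)
      then show "grid n u \<le> u + 1 / real (Suc n)"
        by (simp add: grid_def pos_divide_le_eq del: of_nat_Suc)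
    qed
    show "\<forall>\<^sub>F n in sequentially. grid n u \<in> {u<..} \<and> grid n u \<noteq> u"
      using less by (simp add: less_imp_neq[symmetric])
    have "(\<lambda>n. u + 1 / real (Suc n)) \<longlonglongrightarrow> u + 0"
      by (rule tendsto_add[OF tendsto_const LIMSEQ_Suc[OF lim_1_over_n]])
    then have "(\<lambda>n. u + 1 / real (Suc n)) \<longlonglongrightarrow> u" by simp
    then show "(\<lambda>n. grid n u) \<longlonglongrightarrow> u"
      by (rule tendsto_sandwich[OF _ _ tendsto_const, rotated 2])
        (use less le in \<open>simp_all add: less_imp_le del: of_nat_Suc\<close>)
  qed
  then have "\<forall>\<^sub>F n in sequentially. Z (grid n u) w = Z u w"
    using eventually_compose_filterlim[OF right[OF w, of u]] by blast
  then show "(\<lambda>n. case x of (w, u) \<Rightarrow> f (Z (grid n u) w)) \<longlonglongrightarrow> (case x of (w, u) \<Rightarrow> f (Z u w))"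
    unfolding x by (auto intro!: tendsto_eventually elim: eventually_mono)
qed

text \<open>
  The series of the \<open>U k\<close> has finite expectation, so it converges almost surely.
\<close>

lemma (in prob_space) AE_tendsto_0_if_summable_expectation:
  fixes U :: "nat \<Rightarrow> 'a \<Rightarrow> real"
  assumes int: "\<And>k. integrable M (U k)" and nonneg: "\<And>k w. 0 \<le> U k w"
    and "summable (\<lambda>k. expectation (U k))"
  shows "AE w in M. (\<lambda>k. U k w) \<longlonglongrightarrow> 0"
proof -
  have meas: "(\<lambda>w. ennreal (U k w)) \<in> borel_measurable M" for k
    using int[of k] by simp
  have "(\<integral>\<^sup>+w. (\<Sum>k. ennreal (U k w)) \<partial>M) = (\<Sum>k. \<integral>\<^sup>+w. ennreal (U k w) \<partial>M)"
    by (rule nn_integral_suminf[OF meas])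
  also have "\<dots> = (\<Sum>k. ennreal (expectation (U k)))"
    using int nonneg by (simp add: nn_integral_eq_integral)
  also have "\<dots> \<noteq> \<infinity>"
    using assms(3) nonneg by (simp add: suminf_ennreal2 integral_nonneg_AE)
  finally have "AE w in M. (\<Sum>k. ennreal (U k w)) \<noteq> \<infinity>"
    using meas by (intro nn_integral_PInf_AE) auto
  then show ?thesis
  proof eventually_elim
    case (elim w)
    then have "summable (\<lambda>k. U k w)"
      using nonneg by (intro summable_suminf_not_top) auto
    then show ?case by (rule summable_LIMSEQ_zero)
  qed
qed

text \<open>
  For \<open>k\<^sup>2 \<le> t \<le> (k + 1)\<^sup>2\<close> the value \<open>S t\<close> differs from \<open>S (k\<^sup>2)\<close> by at most \<open>B * (2 * k + 1)\<close>, which is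
  negligible compared with \<open>k\<^sup>2\<close>.
\<close>

lemma average_tendsto_0_along_squares:
  fixes S :: "real \<Rightarrow> real"
  assumes squares: "(\<lambda>k. S (real (k\<^sup>2)) / real (k\<^sup>2)) \<longlonglongrightarrow> 0"
    and lip: "\<And>s t. 0 \<le> s \<Longrightarrow> s \<le> t \<Longrightarrow> \<bar>S t - S s\<bar> \<le> B * (t - s)"
  shows "((\<lambda>t. S t / t) \<longlongrightarrow> 0) at_top"
proof -
  have B: "0 \<le> B" using lip[of 0 1] by simp
  define h where "h k = \<bar>S (real (k\<^sup>2)) / real (k\<^sup>2)\<bar> + B * ((2 * real k + 1) / (real k)\<^sup>2)" for k
  have "(\<lambda>k. 2 * (1 / real k) + (1 / real k)\<^sup>2) \<longlonglongrightarrow> 2 * 0 + 0\<^sup>2"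
    by (intro tendsto_intros lim_1_over_n)
  moreover have "2 * (1 / real k) + (1 / real k)\<^sup>2 = (2 * real k + 1) / (real k)\<^sup>2" for k
    by (cases "k = 0") (simp_all add: power2_eq_square field_simps)
  ultimately have "(\<lambda>k. (2 * real k + 1) / (real k)\<^sup>2) \<longlonglongrightarrow> 0"
    by simp
  then have h: "h \<longlonglongrightarrow> 0"
    unfolding h_def using tendsto_add[OF tendsto_rabs_zero[OF squares] tendsto_mult_right_zero] by fastforce
  have "filterlim (\<lambda>t. nat \<lfloor>sqrt t\<rfloor>) sequentially at_top"
    by (intro filterlim_compose[OF filterlim_nat_sequentially]
        filterlim_compose[OF filterlim_floor_sequentially] sqrt_at_top)
  with h have lim: "((\<lambda>t. h (nat \<lfloor>sqrt t\<rfloor>)) \<longlongrightarrow> 0) at_top"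
    by (rule filterlim_compose)
  have "\<forall>\<^sub>F t in at_top. norm (S t / t) \<le> h (nat \<lfloor>sqrt t\<rfloor>)"
    using eventually_ge_at_top[of 1]
  proof eventually_elim
    case (elim t)
    define k where "k = nat \<lfloor>sqrt t\<rfloor>"
    have "1 \<le> sqrt t" using elim by simp
    then have k: "1 \<le> k" "real k \<le> sqrt t" "sqrt t \<le> real k + 1"
      unfolding k_def by (simp_all add: le_nat_iff le_floor_iff)
    have "(real k)\<^sup>2 \<le> t" "t \<le> (real k + 1)\<^sup>2"
      using power_mono[OF k(2), of 2] power_mono[OF k(3), of 2] elim by simp_all
    then have kt: "real (k\<^sup>2) \<le> t" "t - real (k\<^sup>2) \<le> 2 * real k + 1"
      by (simp_all add: power2_eq_square algebra_simps)
    have "\<bar>S t\<bar> \<le> \<bar>S (real (k\<^sup>2))\<bar> + B * (t - real (k\<^sup>2))"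
      using lip[of "real (k\<^sup>2)" t] kt by linarith
    also have "\<dots> \<le> \<bar>S (real (k\<^sup>2))\<bar> + B * (2 * real k + 1)"
      using kt(2) B by (simp add: mult_left_mono)
    finally have "\<bar>S t\<bar> / t \<le> (\<bar>S (real (k\<^sup>2))\<bar> + B * (2 * real k + 1)) / real (k\<^sup>2)"
      using kt(1) k(1) B elim by (intro frac_le) auto
    also have "\<dots> = h k" by (simp add: h_def add_divide_distrib[of "\<bar>_\<bar>"])
    finally show ?case using elim by (simp add: k_def)
  qed
  then show ?thesis using lim by (rule Lim_null_comparison)
qed

section \<open>The ergodic theorem for Markov processes on a finite state space\<close>

locale finite_markov_process = prob_space M
  for M :: "'w measure" +
  fixes F :: "real \<Rightarrow> 'w measure" and G :: "real^'e^'e" and I :: "real \<Rightarrow> 'w \<Rightarrow> 'e::finite"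
  assumes process: "markov_jump_process M F G I"
begin

lemma filtration_F: "filtration (space M) F"
  using process by (simp add: markov_jump_process_def)

lemma subalgebra_F: "0 \<le> t \<Longrightarrow> subalgebra M (F t)"
  using process by (simp add: markov_jump_process_def)

lemma space_F: "space (F t) = space M"
  by (rule filtration.space_F[OF filtration_F])

lemma measurable_F_mono: "s \<le> t \<Longrightarrow> h \<in> measurable (F s) N \<Longrightarrow> h \<in> measurable (F t) N"
  using filtration.sets_F_mono[OF filtration_F, of s t] space_F
  by (auto simp: measurable_def)

lemma adapted: "0 \<le> s \<Longrightarrow> s \<le> t \<Longrightarrow> I s \<in> measurable (F t) (count_space UNIV)"
  using process by (auto simp: markov_jump_process_def intro: measurable_F_mono)

lemma measurable_F_M: "0 \<le> t \<Longrightarrow> h \<in> measurable (F t) N \<Longrightarrow> h \<in> measurable M N"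
  using subalgebra_F measurable_from_subalg by blast

lemma right_locally_const: "w \<in> space M \<Longrightarrow> 0 \<le> t \<Longrightarrow> \<forall>\<^sub>F s in at_right t. I s w = I t w"
  using process by (auto simp: markov_jump_process_def jump_path_def)

lemma borel_measurable_state:
  fixes f :: "'e \<Rightarrow> real"
  shows "0 \<le> s \<Longrightarrow> s \<le> t \<Longrightarrow> (\<lambda>w. f (I s w)) \<in> borel_measurable (F t)"
  by (rule measurable_compose[OF adapted]) simp_all

text \<open>
  Clamping the time to \<open>[0, T]\<close> keeps the process adapted to \<open>F T\<close> and makes it right-continuous on
  the whole line; the clamped process agrees with \<open>I\<close> on \<open>[0, T]\<close>.
\<close>

lemma joint_measurable:
  fixes f :: "'e \<Rightarrow> real"
  assumes "0 \<le> T"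
  shows "(\<lambda>(w, u). f (I (max 0 (min T u)) w)) \<in> borel_measurable (F T \<Otimes>\<^sub>M lborel)"
proof (rule measurable_pair_right_locally_const[where Z = "\<lambda>u. I (max 0 (min T u))"])
  show "I (max 0 (min T u)) \<in> measurable (F T) (count_space UNIV)" for u
    using \<open>0 \<le> T\<close> by (intro adapted) auto
  fix u w
  assume "w \<in> space (F T)"
  then have w: "w \<in> space M" by (simp add: space_F)
  consider "u < 0" | "0 \<le> u" "u < T" | "T \<le> u" by linarith
  then show "\<forall>\<^sub>F v in at_right u. I (max 0 (min T v)) w = I (max 0 (min T u)) w"
  proof cases
    case 1
    have "\<forall>\<^sub>F v in at_right u. v < 0"
      using 1 eventually_at_right_field by blast
    then show ?thesis by eventually_elim (use 1 in auto)
  next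
    case 2
    have "\<forall>\<^sub>F v in at_right u. v \<in> {u<..<T}"
      by (rule eventually_at_right_real[OF 2(2)])
    with right_locally_const[OF w 2(1)] show ?thesis
      by eventually_elim (use 2 in auto)
  next
    case 3
    have "\<forall>\<^sub>F v in at_right u. v \<in> {u<..<u + 1}"
      by (rule eventually_at_right_real) simp
    then show ?thesis by eventually_elim (use 3 in auto)
  qed
qed

lemma integrable_bounded:
  fixes Y :: "'w \<Rightarrow> real"
  assumes "Y \<in> borel_measurable M" "\<And>w. w \<in> space M \<Longrightarrow> \<bar>Y w\<bar> \<le> C"
  shows "integrable M Y"
  using assms by (intro integrable_const_bound[where B = C]) auto

text \<open>
  The law of \<open>I t\<close> as a row vector, weighted by \<open>Y\<close>.
\<close>

definition state_moment :: "('w \<Rightarrow> real) \<Rightarrow> real \<Rightarrow> real^'e" where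
  "state_moment Y t = (\<chi> i. expectation (\<lambda>w. Y w * of_bool (I t w = i)))"

text \<open>
  Statements about \<open>I t\<close> conditional on \<open>F s\<close> are expressed by a bounded weight \<open>Y\<close> that is known at
  time \<open>s\<close>; below, \<open>Y\<close> is the martingale itself.
\<close>

context
  fixes Y :: "'w \<Rightarrow> real" and s C :: real
  assumes s: "0 \<le> s" and Y: "Y \<in> borel_measurable (F s)"
    and bound: "\<And>w. w \<in> space M \<Longrightarrow> \<bar>Y w\<bar> \<le> C"
begin

lemma weight_measurable_M: "Y \<in> borel_measurable M"
  using measurable_F_M[OF s Y] .

lemma integrable_weighted_state:
  fixes h :: "'e \<Rightarrow> real"
  assumes "0 \<le> t"
  shows "integrable M (\<lambda>w. Y w * h (I t w))"
proof (rule integrable_bounded)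
  show "(\<lambda>w. Y w * h (I t w)) \<in> borel_measurable M"
    using weight_measurable_M measurable_F_M[OF assms borel_measurable_state[OF assms order_refl]] by simp
  fix w assume w: "w \<in> space M"
  have "\<bar>h (I t w)\<bar> \<le> Max (range (\<lambda>i. \<bar>h i\<bar>))" by simp
  with bound[OF w] show "\<bar>Y w * h (I t w)\<bar> \<le> C * Max (range (\<lambda>i. \<bar>h i\<bar>))"
    by (simp add: abs_mult mult_mono')
qed

lemma expectation_state:
  assumes "0 \<le> t"
  shows "expectation (\<lambda>w. Y w * (h :: real^'e) $ I t w) = state_moment Y t \<bullet> h"
proof -
  have "h $ i = (\<Sum>j\<in>UNIV. of_bool (i = j) * h $ j)" for i
    by (simp add: of_bool_def if_distrib[where f = "\<lambda>x. x * _"] cong: if_cong)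
  then have "Y w * h $ I t w = (\<Sum>j\<in>UNIV. Y w * of_bool (I t w = j) * h $ j)" for w
    by (metis (no_types, lifting) mult.assoc sum.cong sum_distrib_left)
  then have "expectation (\<lambda>w. Y w * h $ I t w)
    = expectation (\<lambda>w. \<Sum>j\<in>UNIV. Y w * of_bool (I t w = j) * h $ j)"
    by (simp only:)
  also have "\<dots> = (\<Sum>j\<in>UNIV. expectation (\<lambda>w. Y w * of_bool (I t w = j)) * h $ j)"
    using integrable_weighted_state[OF assms, of "\<lambda>i. of_bool (i = _)"]
    by (subst Bochner_Integration.integral_sum) auto
  also have "\<dots> = state_moment Y t \<bullet> h"
    by (simp add: state_moment_def inner_vec_def)
  finally show ?thesis .
qed

text \<open>
  The Markov property, multiplied by a weight that is known at time \<open>s\<close> and integrated.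
\<close>

lemma state_moment_transition:
  assumes "s \<le> t"
  shows "state_moment Y t = state_moment Y s v* mat_exp ((t - s) *\<^sub>R G)"
proof -
  interpret sub: sigma_finite_subalgebra M "F s"
    by (rule finite_measure_subalgebra_is_sigma_finite)
      (simp add: finite_measure_subalgebra_def finite_measure_subalgebra_axioms_def
        subalgebra_F[OF s] finite_measure_axioms)
  have t: "0 \<le> t" using s assms by simp
  let ?P = "mat_exp ((t - s) *\<^sub>R G)"
  have "expectation (\<lambda>w. Y w * of_bool (I t w = j)) = (state_moment Y s v* ?P) $ j" for j
  proof -
    let ?ind = "indicator {w \<in> space M. I t w = j} :: 'w \<Rightarrow> real"
    have ind: "?ind w = of_bool (I t w = j)" if "w \<in> space M" for w
      using that by (simp add: indicator_def)
    have "{w \<in> space M. I t w = j} \<in> sets M"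
      using measurable_sets[OF measurable_F_M[OF t adapted[OF t order_refl]], of "{j}"]
      by (simp add: vimage_def Int_def conj_commute)
    then have meas: "?ind \<in> borel_measurable M" by simp
    have "integrable M (\<lambda>w. Y w * ?ind w)"
      using integrable_weighted_state[OF t, of "\<lambda>i. of_bool (i = j)"]
      by (rule Bochner_Integration.integrable_cong[OF refl, THEN iffD1, rotated]) (simp add: ind)
    note sub.real_cond_exp_intg(2)[OF this Y meas]
    moreover have "expectation (\<lambda>w. Y w * of_bool (I t w = j)) = expectation (\<lambda>w. Y w * ?ind w)"
      by (rule Bochner_Integration.integral_cong) (simp_all add: ind)
    moreover have "expectation (\<lambda>w. Y w * real_cond_exp M (F s) ?ind w)
      = expectation (\<lambda>w. Y w * (\<chi> i. ?P $ i $ j) $ I s w)"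
    proof (rule integral_cong_AE)
      show "(\<lambda>w. Y w * real_cond_exp M (F s) ?ind w) \<in> borel_measurable M"
        using weight_measurable_M borel_measurable_cond_exp2 by simp
      show "(\<lambda>w. Y w * (\<chi> i. ?P $ i $ j) $ I s w) \<in> borel_measurable M"
        using integrable_weighted_state[OF s, of "\<lambda>i. ?P $ i $ j"] by simp
      have "AE w in M. real_cond_exp M (F s) ?ind w = ?P $ I s w $ j"
        using process s assms unfolding markov_jump_process_def by blast
      then show "AE w in M. Y w * real_cond_exp M (F s) ?ind w = Y w * (\<chi> i. ?P $ i $ j) $ I s w"
        by eventually_elim simp
    qed
    ultimately have "expectation (\<lambda>w. Y w * of_bool (I t w = j))
      = state_moment Y s \<bullet> (\<chi> i. ?P $ i $ j)"
      using expectation_state[OF s, of "\<chi> i. ?P $ i $ j"] by metis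
    then show ?thesis by (simp add: inner_vec_def vector_matrix_mult_def)
  qed
  then show ?thesis by (simp add: vec_eq_iff state_moment_def)
qed

lemma kolmogorov_forward:
  assumes "s \<le> t"
  shows "((\<lambda>t. state_moment Y t \<bullet> g) has_vector_derivative state_moment Y t \<bullet> (G *v g)) (at t within {s..})"
proof -
  have "linear (\<lambda>B. (state_moment Y s v* B) \<bullet> g)"
    by (rule linearI) (simp_all add: dot_lmul_matrix matrix_vector_mult_add_rdistrib
        inner_add_right flip: scaleR_matrix_vector_assoc)
  then have lin: "bounded_linear (\<lambda>B. (state_moment Y s v* B) \<bullet> g)"
    by (simp only: linear_conv_bounded_linear)
  have "((\<lambda>t. mat_exp ((t - s) *\<^sub>R G)) has_vector_derivative
      mat_exp ((t - s) *\<^sub>R G) ** G) (at t within {s..})"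
  proof -
    have "((\<lambda>t. t - s) has_vector_derivative 1) (at t within {s..})"
      by (auto intro!: derivative_eq_intros)
    from vector_diff_chain_within[OF this mat_exp_has_vector_derivative]
    show ?thesis by (simp add: o_def)
  qed
  from bounded_linear.has_vector_derivative[OF lin this]
  have "((\<lambda>t. (state_moment Y s v* mat_exp ((t - s) *\<^sub>R G)) \<bullet> g) has_vector_derivative
      state_moment Y t \<bullet> (G *v g)) (at t within {s..})"
    by (simp add: state_moment_transition[OF assms] dot_lmul_matrix flip: vector_matrix_mul_assoc)
  then show ?thesis
  proof (rule has_vector_derivative_transform[rotated 2])
    fix x assume "x \<in> {s..}"
    then show "state_moment Y x \<bullet> g = (state_moment Y s v* mat_exp ((x - s) *\<^sub>R G)) \<bullet> g"
      by (subst state_moment_transition[of x]) simp_all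
  qed (use assms in simp)
qed

text \<open>
  Dynkin's formula under the weight \<open>Y\<close>: the fundamental theorem of calculus applied to the
  forward equation. Only expectations at fixed times occur here; the interchange with the time integral
  along paths is a separate step (\<open>expectation_occupation\<close>).
\<close>

lemma dynkin_integrated:
  assumes "s \<le> t"
  shows "((\<lambda>u. expectation (\<lambda>w. Y w * (G *v g) $ I u w)) has_integral
    expectation (\<lambda>w. Y w * (g $ I t w - g $ I s w))) {s..t}"
proof -
  have "((\<lambda>u. state_moment Y u \<bullet> (G *v g)) has_integral
      state_moment Y t \<bullet> g - state_moment Y s \<bullet> g) {s..t}"
    by (intro fundamental_theorem_of_calculus assms
        has_vector_derivative_within_subset[OF kolmogorov_forward]) auto
  also have "state_moment Y t \<bullet> g - state_moment Y s \<bullet> g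
    = expectation (\<lambda>w. Y w * (g $ I t w - g $ I s w))"
    using s assms by (simp add: right_diff_distrib integrable_weighted_state flip: expectation_state)
  finally show ?thesis
    by (rule has_integral_eq[rotated]) (use s in \<open>simp add: expectation_state\<close>)
qed

end

definition occupation :: "real^'e \<Rightarrow> real \<Rightarrow> real \<Rightarrow> 'w \<Rightarrow> real" where
  "occupation f a b w = integral {a..b} (\<lambda>u. f $ I u w)"

lemma occupation_lebesgue:
  assumes "w \<in> space M" "0 \<le> a" "0 \<le> b"
  shows "(\<lambda>u. f $ I u w) integrable_on {a..b}"
    and "occupation f a b w = (\<integral>u. indicator {a..b} u * f $ I (max 0 (min b u)) w \<partial>lborel)"
proof -
  let ?f = "\<lambda>u. f $ I (max 0 (min b u)) w"
  have "?f \<in> borel_measurable lborel"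
    using measurable_Pair2[OF joint_measurable[OF \<open>0 \<le> b\<close>, of "($) f"], of w] assms(1)
    by (simp add: space_F)
  then have int: "set_integrable lborel {a..b} ?f"
    unfolding set_integrable_def
    by (intro integrableI_bounded_set_indicator[where B = "norm f"])
      (auto simp: component_le_norm_cart emeasure_lborel_Icc_eq)
  have eq: "f $ I u w = ?f u" if "u \<in> {a..b}" for u
    using that \<open>0 \<le> a\<close> by (simp add: min_absorb2 max_absorb2)
  show "(\<lambda>u. f $ I u w) integrable_on {a..b}"
    using set_borel_integral_eq_integral(1)[OF int] by (rule integrable_eq) (simp add: eq)
  have "occupation f a b w = integral {a..b} ?f"
    unfolding occupation_def by (rule integral_cong) (rule eq)
  also have "\<dots> = (\<integral>u. indicator {a..b} u * ?f u \<partial>lborel)"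
    using set_borel_integral_eq_integral(2)[OF int] by (simp add: set_lebesgue_integral_def)
  finally show "occupation f a b w = (\<integral>u. indicator {a..b} u * ?f u \<partial>lborel)" .
qed

lemma occupation_measurable:
  assumes "0 \<le> a" "0 \<le> b"
  shows "occupation f a b \<in> borel_measurable (F b)"
proof -
  have "(\<lambda>(w, u). indicator {a..b} u * f $ I (max 0 (min b u)) w) \<in> borel_measurable (F b \<Otimes>\<^sub>M lborel)"
    using joint_measurable[OF \<open>0 \<le> b\<close>, of "($) f"] by (simp add: case_prod_beta')
  then have "(\<lambda>w. \<integral>u. indicator {a..b} u * f $ I (max 0 (min b u)) w \<partial>lborel) \<in> borel_measurable (F b)"
    by (rule lborel.borel_measurable_lebesgue_integral)
  then show ?thesis
    by (rule measurable_cong[THEN iffD1, rotated])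
      (simp add: space_F occupation_lebesgue(2) assms)
qed

lemma occupation_combine:
  assumes "w \<in> space M" "0 \<le> a" "a \<le> b" "b \<le> c"
  shows "occupation f a c w = occupation f a b w + occupation f b c w"
  unfolding occupation_def
  by (subst Henstock_Kurzweil_Integration.integral_combine[OF assms(3,4)])
    (use assms in \<open>auto intro: occupation_lebesgue(1)\<close>)

lemma occupation_bound:
  assumes "w \<in> space M" "0 \<le> a" "a \<le> b"
  shows "\<bar>occupation f a b w\<bar> \<le> norm f * (b - a)"
proof -
  have "norm (integral (cbox a b) (\<lambda>u. f $ I u w)) \<le> norm f * measure lborel (cbox a b)"
    using assms occupation_lebesgue(1)[of w a b f]
    by (intro has_integral_bound[where f = "\<lambda>u. f $ I u w"] integrable_integral)
      (auto simp: component_le_norm_cart)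
  then show ?thesis using assms by (simp add: occupation_def)
qed

text \<open>
  Fubini's theorem for the clamped process, which is jointly measurable and agrees with \<open>I\<close> on \<open>[s, t]\<close>.
\<close>

lemma expectation_occupation:
  assumes "0 \<le> s" and Y: "Y \<in> borel_measurable (F s)"
    and bound: "\<And>w. w \<in> space M \<Longrightarrow> \<bar>Y w\<bar> \<le> C" and "s \<le> t"
    and int: "((\<lambda>u. expectation (\<lambda>w. Y w * f $ I u w)) has_integral x) {s..t}"
  shows "expectation (\<lambda>w. Y w * occupation f s t w) = x"
proof -
  interpret pair_sigma_finite M lborel ..
  have t: "0 \<le> t" using assms by simp
  let ?h = "\<lambda>w u. indicator {s..t} u * (Y w * f $ I (max 0 (min t u)) w) :: real"
  have YM: "Y \<in> borel_measurable M" by (rule measurable_F_M[OF \<open>0 \<le> s\<close> Y])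
  have C: "0 \<le> C"
    using bound subprob_not_empty order_trans[OF abs_ge_zero] by (meson ex_in_conv)
  have "(\<lambda>(w, u). f $ I (max 0 (min t u)) w) \<in> borel_measurable (M \<Otimes>\<^sub>M lborel)"
  proof -
    have "(\<lambda>w. w) \<in> measurable M (F t)"
      by (rule measurable_F_M[OF t]) simp
    from measurable_compose[OF measurable_Pair[OF measurable_compose[OF measurable_fst this] measurable_snd]
        joint_measurable[OF t, of "($) f"]]
    show ?thesis by (simp add: case_prod_beta')
  qed
  then have meas: "(\<lambda>(w, u). Y w * f $ I (max 0 (min t u)) w) \<in> borel_measurable (M \<Otimes>\<^sub>M lborel)"
    using YM by (simp add: case_prod_beta')
  have "integrable (M \<Otimes>\<^sub>M lborel)
      (\<lambda>x. indicator (space M \<times> {s..t}) x *\<^sub>R (case x of (w, u) \<Rightarrow> Y w * f $ I (max 0 (min t u)) w))"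
  proof (rule integrableI_bounded_set_indicator[where B = "C * norm f"])
    show "emeasure (M \<Otimes>\<^sub>M lborel) (space M \<times> {s..t}) < \<infinity>"
      using \<open>s \<le> t\<close> by (simp add: lborel.emeasure_pair_measure_Times emeasure_space_1)
    show "AE x in M \<Otimes>\<^sub>M lborel. x \<in> space M \<times> {s..t} \<longrightarrow>
        norm (case x of (w, u) \<Rightarrow> Y w * f $ I (max 0 (min t u)) w) \<le> C * norm f"
      using bound C by (auto simp: abs_mult component_le_norm_cart intro!: AE_I2 mult_mono)
  qed (use meas in simp_all)
  then have integrable: "integrable (M \<Otimes>\<^sub>M lborel) (case_prod ?h)"
    by (rule Bochner_Integration.integrable_cong[OF refl, THEN iffD1, rotated])
      (auto simp: space_pair_measure indicator_def)
  have "expectation (\<lambda>w. Y w * occupation f s t w) = expectation (\<lambda>w. \<integral>u. ?h w u \<partial>lborel)"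
  proof (rule Bochner_Integration.integral_cong[OF refl])
    fix w assume "w \<in> space M"
    then have "Y w * occupation f s t w
      = Y w * (\<integral>u. indicator {s..t} u * f $ I (max 0 (min t u)) w \<partial>lborel)"
      using assms t by (simp add: occupation_lebesgue(2))
    also have "\<dots> = (\<integral>u. Y w * (indicator {s..t} u * f $ I (max 0 (min t u)) w) \<partial>lborel)"
      by simp
    finally show "Y w * occupation f s t w = (\<integral>u. ?h w u \<partial>lborel)" by (simp add: mult_ac)
  qed
  also have "\<dots> = (\<integral>u. expectation (\<lambda>w. ?h w u) \<partial>lborel)"
    by (rule Fubini_integral[OF integrable, symmetric])
  also have "\<dots> = (\<integral>u. indicator {s..t} u *\<^sub>R expectation (\<lambda>w. Y w * f $ I (max 0 (min t u)) w) \<partial>lborel)"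
    by simp
  also have "\<dots> = integral {s..t} (\<lambda>u. expectation (\<lambda>w. Y w * f $ I (max 0 (min t u)) w))"
  proof -
    have "integrable lborel (\<lambda>u. expectation (\<lambda>w. ?h w u))"
      using integrable_snd[OF integrable] by simp
    then have "set_integrable lborel {s..t} (\<lambda>u. expectation (\<lambda>w. Y w * f $ I (max 0 (min t u)) w))"
      by (simp add: set_integrable_def)
    from set_borel_integral_eq_integral(2)[OF this]
    show ?thesis by (simp add: set_lebesgue_integral_def)
  qed
  also have "\<dots> = integral {s..t} (\<lambda>u. expectation (\<lambda>w. Y w * f $ I u w))"
    by (rule integral_cong) (use \<open>0 \<le> s\<close> in \<open>auto simp: min_absorb2 max_absorb2\<close>)
  also have "\<dots> = x" using int by (rule integral_unique)
  finally show ?thesis .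
qed

definition dynkin_martingale :: "real^'e \<Rightarrow> nat \<Rightarrow> 'w \<Rightarrow> real" where
  "dynkin_martingale g n w = g $ I (real n) w - g $ I 0 w - occupation (G *v g) 0 (real n) w"

lemma dynkin_martingale_measurable:
  "dynkin_martingale g n \<in> borel_measurable (F (real n))"
  unfolding dynkin_martingale_def
  by (intro borel_measurable_diff borel_measurable_state occupation_measurable) simp_all

lemma dynkin_martingale_bound:
  assumes "w \<in> space M"
  shows "\<bar>dynkin_martingale g n w\<bar> \<le> 2 * norm g + norm (G *v g) * real n"
  using occupation_bound[OF assms order_refl of_nat_0_le_iff, of "G *v g" n]
    component_le_norm_cart[of g "I (real n) w"] component_le_norm_cart[of g "I 0 w"]
  unfolding dynkin_martingale_def by simp

lemma dynkin_martingale_step: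
  assumes "w \<in> space M"
  shows "dynkin_martingale g (Suc n) w = dynkin_martingale g n w
    + (g $ I (real (Suc n)) w - g $ I (real n) w - occupation (G *v g) (real n) (real (Suc n)) w)"
  using occupation_combine[OF assms, of 0 "real n" "real (Suc n)" "G *v g"]
  by (simp add: dynkin_martingale_def)

text \<open>
  The increments over unit time intervals are bounded and orthogonal to the past, so their second moments add up.
\<close>

lemma dynkin_martingale_second_moment:
  "expectation (\<lambda>w. (dynkin_martingale g n w)\<^sup>2) \<le> real n * (2 * norm g + norm (G *v g))\<^sup>2"
proof (induction n)
  case 0
  then show ?case by (simp add: dynkin_martingale_def occupation_def)
next
  case (Suc n)
  let ?N = "dynkin_martingale g n" and ?K = "2 * norm g + norm (G *v g)"
  define B where "B = 2 * norm g + norm (G *v g) * real n"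
  define D where "D w = g $ I (real (Suc n)) w - g $ I (real n) w
    - occupation (G *v g) (real n) (real (Suc n)) w" for w
  have N_bound: "\<bar>?N w\<bar> \<le> B" if "w \<in> space M" for w
    using dynkin_martingale_bound[OF that] by (simp add: B_def)
  have D_bound: "\<bar>D w\<bar> \<le> ?K" if "w \<in> space M" for w
    using occupation_bound[OF that, of "real n" "real (Suc n)" "G *v g"]
      component_le_norm_cart[of g "I (real (Suc n)) w"] component_le_norm_cart[of g "I (real n) w"]
    unfolding D_def by auto
  have N_M: "?N \<in> borel_measurable M"
    using measurable_F_M[OF _ dynkin_martingale_measurable] by simp
  have occ_M: "occupation (G *v g) (real n) (real (Suc n)) \<in> borel_measurable M"
    by (rule measurable_F_M[OF _ occupation_measurable]) simp_all
  have state_M: "(\<lambda>w. g $ I (real k) w) \<in> borel_measurable M" for k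
    by (rule measurable_F_M[where t = "real k", OF _ borel_measurable_state]) simp_all
  have D_M: "D \<in> borel_measurable M"
    unfolding D_def by (intro borel_measurable_diff state_M occ_M)
  have int_N2: "integrable M (\<lambda>w. (?N w)\<^sup>2)"
    using N_M power_mono[OF N_bound abs_ge_zero, of _ 2]
    by (intro integrable_bounded[where C = "B\<^sup>2"]) auto
  have int_D2: "integrable M (\<lambda>w. (D w)\<^sup>2)"
    using D_M power_mono[OF D_bound abs_ge_zero, of _ 2]
    by (intro integrable_bounded[where C = "?K\<^sup>2"]) auto
  have int_ND: "integrable M (\<lambda>w. ?N w * D w)"
    using N_M D_M mult_mono[OF N_bound D_bound _ abs_ge_zero]
    by (intro integrable_bounded[where C = "B * ?K"]) (auto simp: abs_mult B_def)
  \<comment> \<open>orthogonality of the increment to the past\<close>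
  have "expectation (\<lambda>w. ?N w * D w) = 0"
  proof -
    have int_occ: "integrable M (\<lambda>w. ?N w * occupation (G *v g) (real n) (real (Suc n)) w)"
      using N_M occ_M mult_mono[OF N_bound occupation_bound[of _ "real n" "real (Suc n)" "G *v g"] _ abs_ge_zero]
      by (intro integrable_bounded[where C = "B * norm (G *v g)"]) (auto simp: abs_mult B_def)
    have int_state: "integrable M (\<lambda>w. ?N w * (g $ I (real (Suc n)) w - g $ I (real n) w))"
      using integrable_weighted_state[OF _ dynkin_martingale_measurable N_bound, of "real (Suc n)" "($) g"]
        integrable_weighted_state[OF _ dynkin_martingale_measurable N_bound, of "real n" "($) g"]
      by (simp add: right_diff_distrib)
    have "expectation (\<lambda>w. ?N w * occupation (G *v g) (real n) (real (Suc n)) w)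
      = expectation (\<lambda>w. ?N w * (g $ I (real (Suc n)) w - g $ I (real n) w))"
      by (rule expectation_occupation[OF _ dynkin_martingale_measurable N_bound])
        (auto intro!: dynkin_integrated[OF _ dynkin_martingale_measurable N_bound])
    then show ?thesis
      using int_occ int_state by (simp add: D_def right_diff_distrib[of "?N _" "_ - _"])
  qed
  moreover have "expectation (\<lambda>w. (dynkin_martingale g (Suc n) w)\<^sup>2)
    = expectation (\<lambda>w. (?N w)\<^sup>2 + 2 * (?N w * D w) + (D w)\<^sup>2)"
    by (rule Bochner_Integration.integral_cong)
      (simp_all add: dynkin_martingale_step D_def power2_sum)
  moreover have "expectation (\<lambda>w. (D w)\<^sup>2) \<le> ?K\<^sup>2"
  proof -
    have "expectation (\<lambda>w. (D w)\<^sup>2) \<le> expectation (\<lambda>w. ?K\<^sup>2)"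
      using int_D2 power_mono[OF D_bound abs_ge_zero, of _ 2] by (intro integral_mono) auto
    then show ?thesis by (simp add: prob_space)
  qed
  moreover have "expectation (\<lambda>w. (?N w)\<^sup>2 + 2 * (?N w * D w) + (D w)\<^sup>2)
    = expectation (\<lambda>w. (?N w)\<^sup>2) + 2 * expectation (\<lambda>w. ?N w * D w) + expectation (\<lambda>w. (D w)\<^sup>2)"
    using int_N2 int_ND int_D2 by simp
  moreover have "real (Suc n) * ?K\<^sup>2 = real n * ?K\<^sup>2 + ?K\<^sup>2"
    by (simp add: distrib_right)
  ultimately show ?case
    using Suc by linarith
qed

text \<open>
  By the second moment bound the time averages of the martingale are almost surely null along the
  squares \<open>k\<^sup>2\<close>, where the second moments are of order \<open>1 / k\<^sup>2\<close>. The boundary terms \<open>g (I t) - g (I 0)\<close>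
  are bounded and vanish in the average.
\<close>

lemma occupation_average_null:
  "AE w in M. ((\<lambda>t. occupation (G *v g) 0 t w / t) \<longlongrightarrow> 0) at_top"
proof -
  let ?K = "2 * norm g + norm (G *v g)"
  define U where "U = (\<lambda>k w. (dynkin_martingale g (k\<^sup>2) w / real (k\<^sup>2))\<^sup>2)"
  have int: "integrable M (U k)" for k
  proof -
    have "dynkin_martingale g (k\<^sup>2) \<in> borel_measurable M"
      by (rule measurable_F_M[OF _ dynkin_martingale_measurable]) simp
    then have "integrable M (\<lambda>w. (dynkin_martingale g (k\<^sup>2) w)\<^sup>2)"
      using power_mono[OF dynkin_martingale_bound abs_ge_zero, of _ g "k\<^sup>2" 2]
      by (intro integrable_bounded[where C = "(2 * norm g + norm (G *v g) * real (k\<^sup>2))\<^sup>2"]) auto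
    then show ?thesis by (simp add: U_def power_divide)
  qed
  have U_nonneg: "0 \<le> U k w" for k w
    by (simp add: U_def)
  have "expectation (U k) \<le> ?K\<^sup>2 * inverse ((real k)\<^sup>2)" for k
  proof (cases "k = 0")
    case False
    have "expectation (U k) = expectation (\<lambda>w. (dynkin_martingale g (k\<^sup>2) w)\<^sup>2) / (real (k\<^sup>2))\<^sup>2"
      by (simp add: U_def power_divide)
    also have "\<dots> \<le> (real (k\<^sup>2) * ?K\<^sup>2) / (real (k\<^sup>2))\<^sup>2"
      by (intro divide_right_mono dynkin_martingale_second_moment) simp
    also have "\<dots> = ?K\<^sup>2 * inverse ((real k)\<^sup>2)"
      using False by (simp add: power2_eq_square field_simps)
    finally show ?thesis .
  qed (simp add: U_def)
  moreover have "0 \<le> expectation (U k)" for k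
    by (rule Bochner_Integration.integral_nonneg) (rule U_nonneg)
  ultimately have "norm (expectation (U k)) \<le> ?K\<^sup>2 * inverse ((real k)\<^sup>2)" for k
    unfolding real_norm_def by (simp only: abs_of_nonneg)
  moreover have "summable (\<lambda>k. ?K\<^sup>2 * inverse ((real k)\<^sup>2))"
    by (intro summable_mult inverse_power_summable) simp
  ultimately have "summable (\<lambda>k. expectation (U k))"
    by (rule summable_comparison_test'[rotated])
  then have "AE w in M. (\<lambda>k. U k w) \<longlonglongrightarrow> 0"
    by (rule AE_tendsto_0_if_summable_expectation[OF int U_nonneg])
  then show ?thesis
    using AE_space
  proof eventually_elim
    case (elim w)
    have mart: "(\<lambda>k. dynkin_martingale g (k\<^sup>2) w / real (k\<^sup>2)) \<longlonglongrightarrow> 0"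
      using tendsto_real_sqrt[OF elim(1)] unfolding U_def real_sqrt_abs real_sqrt_zero
      by (rule tendsto_rabs_zero_cancel)
    have "(\<lambda>k. (g $ I (real (k\<^sup>2)) w - g $ I 0 w) / real (k\<^sup>2)) \<longlonglongrightarrow> 0"
    proof (rule Lim_null_comparison)
      show "\<forall>\<^sub>F k in sequentially.
          norm ((g $ I (real (k\<^sup>2)) w - g $ I 0 w) / real (k\<^sup>2)) \<le> 2 * norm g / (real k)\<^sup>2"
      proof (rule always_eventually, rule allI)
        fix k
        have "\<bar>g $ I (real (k\<^sup>2)) w - g $ I 0 w\<bar> \<le> 2 * norm g"
          using component_le_norm_cart[of g "I (real (k\<^sup>2)) w"] component_le_norm_cart[of g "I 0 w"]
          by linarith
        then show "norm ((g $ I (real (k\<^sup>2)) w - g $ I 0 w) / real (k\<^sup>2)) \<le> 2 * norm g / (real k)\<^sup>2"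
          by (simp add: divide_right_mono)
      qed
      show "(\<lambda>k. 2 * norm g / (real k)\<^sup>2) \<longlonglongrightarrow> 0"
      proof -
        have "(\<lambda>k. 2 * norm g * (1 / real k)\<^sup>2) \<longlonglongrightarrow> 2 * norm g * 0\<^sup>2"
          by (intro tendsto_intros lim_1_over_n)
        then show ?thesis by (simp add: power_divide)
      qed
    qed
    from tendsto_diff[OF this mart]
    have "(\<lambda>k. occupation (G *v g) 0 (real (k\<^sup>2)) w / real (k\<^sup>2)) \<longlonglongrightarrow> 0"
      by (simp add: dynkin_martingale_def diff_divide_distrib)
    moreover have "\<bar>occupation (G *v g) 0 t w - occupation (G *v g) 0 s w\<bar>
        \<le> norm (G *v g) * (t - s)" if "0 \<le> s" "s \<le> t" for s t
      using occupation_combine[OF elim(2), of 0 s t "G *v g"]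
        occupation_bound[OF elim(2), of s t "G *v g"] that by simp
    ultimately show ?case by (rule average_tendsto_0_along_squares)
  qed
qed

text \<open>
  The function \<open>1\<^bsub>{i}\<^esub> - p $ i\<close> has mean zero under \<open>p\<close>, so it is in the range of \<open>Q\<close> and its
  occupation averages vanish.
\<close>

lemma ergodic_averages:
  assumes G: "G = r *\<^sub>R Q" "0 < r" and Q: "irreducible_generator Q"
    and p: "probability_vector p" "p v* Q = 0"
  shows "AE w in M. \<forall>i. ((\<lambda>t. integral {0..t} (\<lambda>u. of_bool (I u w = i)) / t) \<longlongrightarrow> p $ i) at_top"
proof -
  have "AE w in M. ((\<lambda>t. integral {0..t} (\<lambda>u. of_bool (I u w = i)) / t) \<longlongrightarrow> p $ i) at_top" for i
  proof -
    define f :: "real^'e" where "f = (\<chi> j. of_bool (j = i) - p $ i)"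
    have "p \<bullet> f = (\<Sum>j\<in>UNIV. if j = i then p $ j else 0) - (\<Sum>j\<in>UNIV. p $ j) * p $ i"
      unfolding inner_vec_def f_def
      by (simp add: right_diff_distrib sum_subtractf sum_distrib_right of_bool_def
          if_distrib[where f = "\<lambda>c. _ * c"] cong: if_cong)
    also have "\<dots> = 0" using p(1) by (simp add: probability_vector_def)
    finally obtain g where "Q *v g = f"
      using poisson_equation_solvable[OF Q p] by blast
    then have "G *v (inverse r *\<^sub>R g) = f"
      using G by (simp add: matrix_vector_mult_scaleR flip: scaleR_matrix_vector_assoc)
    then have "AE w in M. ((\<lambda>t. occupation f 0 t w / t) \<longlongrightarrow> 0) at_top"
      using occupation_average_null[of "inverse r *\<^sub>R g"] by simp
    then show ?thesis
      using AE_space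
    proof eventually_elim
      case (elim w)
      have "\<forall>\<^sub>F t in at_top. occupation f 0 t w / t + p $ i
          = integral {0..t} (\<lambda>u. of_bool (I u w = i)) / t"
        using eventually_gt_at_top[of 0]
      proof eventually_elim
        case (elim t)
        have "(\<lambda>u. f $ I u w + p $ i) = (\<lambda>u. of_bool (I u w = i))"
          by (simp add: f_def)
        moreover have "integral {0..t} (\<lambda>u. f $ I u w + p $ i) = occupation f 0 t w + p $ i * t"
          using elim Henstock_Kurzweil_Integration.integral_add[OF
              occupation_lebesgue(1)[OF \<open>w \<in> space M\<close>, of 0 t f] integrable_const_ivl[of "p $ i" 0 t]]
          by (simp add: occupation_def)
        ultimately show ?case using elim by (simp add: field_simps)
      qed
      moreover have "((\<lambda>t. occupation f 0 t w / t + p $ i) \<longlongrightarrow> 0 + p $ i) at_top"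
        by (intro tendsto_add elim tendsto_const)
      ultimately show ?case
        using tendsto_cong by fastforce
    qed
  qed
  then show ?thesis by (simp add: AE_all_countable)
qed

end

section \<open>Switched linear flows with commuting matrices\<close>

lemma has_integral_cong_interior:
  fixes f g :: "real \<Rightarrow> 'b::banach"
  assumes "(g has_integral y) {a..b}" "\<And>u. a < u \<Longrightarrow> u < b \<Longrightarrow> f u = g u"
  shows "(f has_integral y) {a..b}"
  using assms has_integral_spike_interior[of g y a b f] by (simp add: box_real)

lemma constant_coefficients_solution:
  fixes A :: "real^'d^'d" and X :: "real \<Rightarrow> real^'d"
  assumes X: "\<And>s. s \<in> {a..b} \<Longrightarrow> ((\<lambda>u. A *v X u) has_integral X s - X a) {a..s}"
    and cont: "continuous_on {a..b} X" and s: "s \<in> {a..b}"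
  shows "endo_apply (exp ((a - s) *\<^sub>R endo_of A)) (X s) = X a"
proof -
  let ?B = "endo_of A"
  define W where "W s = endo_apply (exp ((a - s) *\<^sub>R ?B)) (X s)" for s
  have "(W has_derivative (\<lambda>h. 0)) (at s within {a..b})" if s: "s \<in> {a..b}" for s
  proof -
    have "continuous_on {a..b} (\<lambda>u. A *v X u)"
      by (intro matrix_vector_mult_linear_continuous_on[THEN continuous_on_compose2, OF cont]) auto
    then have "((\<lambda>u. X a + integral {a..u} (\<lambda>u. A *v X u)) has_vector_derivative 0 + A *v X s)
        (at s within {a..b})"
      using s by (intro derivative_intros integral_has_vector_derivative)
    then have "(X has_vector_derivative 0 + A *v X s) (at s within {a..b})"
    proof (rule has_vector_derivative_transform[OF s, rotated])
      fix u assume "u \<in> {a..b}"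
      from integral_unique[OF X[OF this]]
      show "X u = X a + integral {a..u} (\<lambda>u. A *v X u)" by simp
    qed
    then have dX: "(X has_vector_derivative A *v X s) (at s within {a..b})" by simp
    have "((\<lambda>s. a - s) has_vector_derivative - 1) (at s within {a..b})"
      by (auto intro!: derivative_eq_intros)
    from vector_diff_chain_within[OF this exp_scaleR_has_vector_derivative_right]
    have "((\<lambda>s. exp ((a - s) *\<^sub>R ?B)) has_vector_derivative - (exp ((a - s) *\<^sub>R ?B) * ?B))
        (at s within {a..b})"
      by (simp add: o_def)
    from endo_apply.has_vector_derivative[OF this dX]
    show ?thesis
      by (simp add: W_def[abs_def] endo_apply.minus_left has_vector_derivative_def)
  qed
  then obtain c where "\<And>s. s \<in> {a..b} \<Longrightarrow> W s = c"
    using has_derivative_zero_constant[of "{a..b}" W] by auto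
  then have "W s = W a" using s by auto
  then show ?thesis by (simp add: W_def)
qed

locale commuting_switched_flow =
  fixes A :: "'e::finite \<Rightarrow> real^'d^'d" and x :: "real \<Rightarrow> 'e" and X :: "real \<Rightarrow> real^'d"
  assumes path: "jump_path x"
    and commute: "A i ** A j = A j ** A i"
    and solution: "0 \<le> t \<Longrightarrow> ((\<lambda>s. A (x s) *v X s) has_integral X t - X 0) {0..t}"
    and time_integrable: "0 \<le> t \<Longrightarrow> (\<lambda>s. of_bool (x s = i) :: real) integrable_on {0..t}"
begin

definition time_in :: "'e \<Rightarrow> real \<Rightarrow> real" where
  "time_in i t = integral {0..t} (\<lambda>s. of_bool (x s = i))"

definition generator_sum :: "real \<Rightarrow> (real^'d) endo" where
  "generator_sum t = (\<Sum>i\<in>UNIV. time_in i t *\<^sub>R endo_of (A i))"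

lemma endo_of_commute: "endo_of (A i) * endo_of (A j) = endo_of (A j) * endo_of (A i)"
  by (simp add: commute flip: endo_of_mult)

lemma weighted_sum_commute:
  "(\<Sum>i\<in>UNIV. c i *\<^sub>R endo_of (A i)) * endo_of (A j) = endo_of (A j) * (\<Sum>i\<in>UNIV. c i *\<^sub>R endo_of (A i))"
  by (simp add: sum_distrib_left sum_distrib_right endo_of_commute)

lemma weighted_sums_commute:
  "(\<Sum>i\<in>UNIV. c i *\<^sub>R endo_of (A i)) * (\<Sum>j\<in>UNIV. d j *\<^sub>R endo_of (A j))
    = (\<Sum>j\<in>UNIV. d j *\<^sub>R endo_of (A j)) * (\<Sum>i\<in>UNIV. c i *\<^sub>R endo_of (A i))"
proof -
  define S where "S = (\<Sum>i\<in>UNIV. c i *\<^sub>R endo_of (A i))"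
  have "S * endo_of (A j) = endo_of (A j) * S" for j
    unfolding S_def by (rule weighted_sum_commute)
  then have "S * (\<Sum>j\<in>UNIV. d j *\<^sub>R endo_of (A j)) = (\<Sum>j\<in>UNIV. d j *\<^sub>R endo_of (A j)) * S"
    by (simp add: sum_distrib_left sum_distrib_right)
  then show ?thesis by (simp only: S_def)
qed

lemma continuous_X: "0 \<le> a \<Longrightarrow> continuous_on {a..b} X"
proof -
  assume "0 \<le> a"
  show ?thesis
  proof (cases "0 \<le> b")
    case True
    have "continuous_on {0..b} (\<lambda>t. X 0 + integral {0..t} (\<lambda>s. A (x s) *v X s))"
      using solution[OF True] by (intro continuous_intros indefinite_integral_continuous_1) blast
    then have "continuous_on {0..b} X"
      by (rule continuous_on_eq) (simp add: integral_unique[OF solution])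
    then show ?thesis by (rule continuous_on_subset) (use \<open>0 \<le> a\<close> in auto)
  qed (use \<open>0 \<le> a\<close> in simp)
qed

text \<open>
  While the path stays in \<open>j\<close>, only the time in \<open>j\<close> grows, so \<open>exp (- generator_sum s)\<close> picks up the factor
  \<open>exp ((a - s) *\<^sub>R A j)\<close>, by commutativity, and this factor undoes the motion of \<open>X\<close>. The path may
  jump at both end points, which is invisible to the integrals.
\<close>

lemma flow_constant_between_jumps:
  assumes "0 \<le> a" and const: "\<And>u. a < u \<Longrightarrow> u < b \<Longrightarrow> x u = j" and s: "s \<in> {a..b}"
  shows "endo_apply (exp (- generator_sum s)) (X s) = endo_apply (exp (- generator_sum a)) (X a)"
proof -
  let ?B = "endo_of (A j)"
  have "0 \<le> s" "a \<le> s" using s \<open>0 \<le> a\<close> by auto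
  have "time_in i s = time_in i a + of_bool (i = j) * (s - a)" for i
  proof -
    have "((\<lambda>u. of_bool (x u = i) :: real) has_integral of_bool (i = j) * (s - a)) {a..s}"
    proof (rule has_integral_cong_interior)
      show "((\<lambda>u. of_bool (i = j)) has_integral of_bool (i = j) * (s - a)) {a..s}"
        using has_integral_const_real[of "of_bool (i = j) :: real" a s] \<open>a \<le> s\<close>
        by (simp add: mult.commute)
    qed (use s in \<open>auto simp: const\<close>)
    then have "integral {a..s} (\<lambda>u. of_bool (x u = i) :: real) = of_bool (i = j) * (s - a)"
      by (rule integral_unique)
    moreover have "time_in i s = time_in i a + integral {a..s} (\<lambda>u. of_bool (x u = i))"
      unfolding time_in_def
      by (rule Henstock_Kurzweil_Integration.integral_combine[symmetric,
            OF \<open>0 \<le> a\<close> \<open>a \<le> s\<close> time_integrable[OF \<open>0 \<le> s\<close>]])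
    ultimately show ?thesis by simp
  qed
  then have "generator_sum s
    = generator_sum a + (\<Sum>i\<in>UNIV. if i = j then (s - a) *\<^sub>R endo_of (A i) else 0)"
    unfolding generator_sum_def
    by (simp add: scaleR_add_left sum.distrib of_bool_def if_distrib[where f = "\<lambda>c. (c * _) *\<^sub>R _"] cong: if_cong)
  then have "- generator_sum s = - generator_sum a + (a - s) *\<^sub>R ?B"
    by (simp add: algebra_simps)
  moreover have "- generator_sum a * ((a - s) *\<^sub>R ?B) = (a - s) *\<^sub>R ?B * - generator_sum a"
    by (simp add: generator_sum_def weighted_sum_commute)
  ultimately have exp_split: "exp (- generator_sum s) = exp (- generator_sum a) * exp ((a - s) *\<^sub>R ?B)"
    by (simp only: exp_add_commuting)
  have "endo_apply (exp ((a - s) *\<^sub>R ?B)) (X s) = X a"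
  proof (rule constant_coefficients_solution[OF _ _ s])
    show "continuous_on {a..b} X" by (rule continuous_X[OF \<open>0 \<le> a\<close>])
    fix t assume t: "t \<in> {a..b}"
    let ?f = "\<lambda>u. A (x u) *v X u"
    have t0: "0 \<le> t" "a \<le> t" using t \<open>0 \<le> a\<close> by auto
    have int: "?f integrable_on {0..t}" using solution[OF t0(1)] by blast
    have "integral {0..a} ?f + integral {a..t} ?f = integral {0..t} ?f"
      using \<open>0 \<le> a\<close> t0(2) int by (rule Henstock_Kurzweil_Integration.integral_combine)
    then have "integral {a..t} ?f = X t - X a"
      using integral_unique[OF solution] \<open>0 \<le> a\<close> t0(1) by (simp add: algebra_simps)
    moreover have "?f integrable_on {a..t}"
      using int by (rule integrable_on_subinterval) (use \<open>0 \<le> a\<close> in auto)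
    ultimately have "(?f has_integral X t - X a) {a..t}"
      using integrable_integral by metis
    then show "((\<lambda>u. A j *v X u) has_integral X t - X a) {a..t}"
      by (rule has_integral_cong_interior) (use t in \<open>simp add: const\<close>)
  qed
  then show ?thesis by (simp add: exp_split)
qed

text \<open>
  Undoing the flow gives a locally constant function on \<open>[0, \<infinity>)\<close>, hence a constant one.
\<close>

lemma solution_eq_exp:
  assumes "0 \<le> t"
  shows "X t = endo_apply (exp (generator_sum t)) (X 0)"
proof -
  define Z where "Z t = endo_apply (exp (- generator_sum t)) (X t)" for t
  \<comment> \<open>Each time has a path-constant interval on either side, so \<open>Z\<close> is locally constant, jump times included.\<close>
  have right: "\<forall>\<^sub>F s in at_right u. Z s = Z u" if "0 \<le> u" for u
  proof -
    have "\<forall>\<^sub>F s in at_right u. x s = x u"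
      using path that by (simp add: jump_path_def)
    then obtain b where "u < b" and b: "\<And>s. u < s \<Longrightarrow> s < b \<Longrightarrow> x s = x u"
      unfolding eventually_at_right_field by blast
    have "Z s = Z u" if "s \<in> {u<..<b}" for s
      unfolding Z_def using that \<open>0 \<le> u\<close>
      by (intro flow_constant_between_jumps[of u b "x u"] b) auto
    then show ?thesis
      using eventually_at_right_real[OF \<open>u < b\<close>] by (auto elim: eventually_mono)
  qed
  have left: "\<forall>\<^sub>F s in at_left u. Z s = Z u" if "0 < u" for u
  proof -
    have "\<exists>j. \<forall>\<^sub>F s in at_left u. x s = j"
      using path that by (simp add: jump_path_def)
    then obtain j where "\<forall>\<^sub>F s in at_left u. x s = j" ..
    then obtain a where "a < u" and a: "\<And>s. a < s \<Longrightarrow> s < u \<Longrightarrow> x s = j"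
      unfolding eventually_at_left_field by blast
    have "Z s = Z u" if s: "s \<in> {max 0 a<..<u}" for s
    proof -
      have "Z u = Z s"
        unfolding Z_def using s by (intro flow_constant_between_jumps[of s u j] a) auto
      then show ?thesis by simp
    qed
    then show ?thesis
      using eventually_at_left_real[of "max 0 a" u] \<open>a < u\<close> \<open>0 < u\<close> by (auto elim: eventually_mono)
  qed
  have "(Z has_derivative (\<lambda>h. 0)) (at u within {0..})" if u: "u \<in> {0..}" for u
  proof -
    have "\<forall>\<^sub>F s in at u within {0..}. Z s = Z u"
    proof (cases "u = 0")
      case True
      then show ?thesis using right[of 0] by (simp add: at_within_Ici_at_right)
    next
      case False
      then have "\<forall>\<^sub>F s in at u. Z s = Z u"
        using left[of u] right[of u] u by (simp add: eventually_at_split)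
      then show ?thesis by (rule filter_leD[OF at_le, rotated]) simp
    qed
    then have "\<forall>\<^sub>F s in at u within {0..}. Z u = Z s"
      by eventually_elim simp
    then show ?thesis
      using has_derivative_transform_eventually[OF has_derivative_const[of "Z u"]] u by blast
  qed
  then obtain c where "\<And>u. u \<in> {0..} \<Longrightarrow> Z u = c"
    using has_derivative_zero_constant[of "{0..}" Z] by auto
  then have "Z t = Z 0" using \<open>0 \<le> t\<close> by auto
  also have "Z 0 = X 0"
    by (simp add: Z_def generator_sum_def time_in_def)
  finally have "endo_apply (exp (generator_sum t)) (X 0)
    = endo_apply (exp (generator_sum t) * exp (- generator_sum t)) (X t)"
    by (simp add: Z_def)
  then show ?thesis by (simp add: exp_minus_inverse)
qed

text \<open>
  The exponent splits into \<open>t *\<^sub>R Abar\<close> and a commuting remainder, whose norm is at most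
  \<open>c / 2 * t\<close> for large \<open>t\<close>; that is half of the decay rate \<open>c\<close> of the first part.
\<close>

lemma solution_tendsto_0:
  assumes "hurwitz (\<Sum>i\<in>UNIV. p $ i *\<^sub>R A i)"
    and averages: "\<And>i. ((\<lambda>t. time_in i t / t) \<longlongrightarrow> p $ i) at_top"
  shows "((\<lambda>t. norm (X t)) \<longlongrightarrow> 0) at_top"
proof -
  define Abar where "Abar = (\<Sum>i\<in>UNIV. p $ i *\<^sub>R A i)"
  obtain C c where "0 < c" and
    decay: "\<And>t. t \<ge> 0 \<Longrightarrow> norm (endo_apply (exp (t *\<^sub>R endo_of Abar)) (X 0)) \<le> C * exp (- (c * t))"
    using hurwitz_exp_decay[OF assms(1), of "X 0"] unfolding Abar_def by blast
  define rest where "rest t = (\<Sum>i\<in>UNIV. (time_in i t - p $ i * t) *\<^sub>R endo_of (A i))" for t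
  define err where "err t = (\<Sum>i\<in>UNIV. \<bar>time_in i t / t - p $ i\<bar> * norm (endo_of (A i)))" for t
  have scaled: "t *\<^sub>R endo_of Abar = (\<Sum>i\<in>UNIV. (p $ i * t) *\<^sub>R endo_of (A i))" for t
    by (simp add: Abar_def endo_of_sum endo_of_scaleR scaleR_sum_right mult.commute)
  have "generator_sum t = rest t + t *\<^sub>R endo_of Abar" for t
    unfolding scaled by (simp add: generator_sum_def rest_def scaleR_diff_left sum_subtractf)
  moreover have "rest t * (t *\<^sub>R endo_of Abar) = t *\<^sub>R endo_of Abar * rest t" for t
    unfolding scaled rest_def by (rule weighted_sums_commute)
  ultimately have split: "exp (generator_sum t) = exp (rest t) * exp (t *\<^sub>R endo_of Abar)" for t
    by (simp add: exp_add_commuting)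
  have rest_le: "norm (rest t) \<le> err t * t" if "0 < t" for t
  proof -
    have "norm (rest t) \<le> (\<Sum>i\<in>UNIV. \<bar>time_in i t - p $ i * t\<bar> * norm (endo_of (A i)))"
      unfolding rest_def by (rule order_trans[OF norm_sum]) simp
    also have "\<dots> = err t * t"
    proof -
      have "\<bar>time_in i t - p $ i * t\<bar> = \<bar>time_in i t / t - p $ i\<bar> * t" for i
      proof -
        have "time_in i t - p $ i * t = (time_in i t / t - p $ i) * t"
          using that by (simp add: left_diff_distrib)
        then show ?thesis using that by (simp add: abs_mult)
      qed
      then show ?thesis by (simp add: err_def sum_distrib_left mult_ac)
    qed
    finally show ?thesis .
  qed
  have "((\<lambda>t. time_in i t / t - p $ i) \<longlongrightarrow> 0) at_top" for i
    using averages[of i] by (simp add: LIM_zero)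
  then have "(err \<longlongrightarrow> (\<Sum>i\<in>(UNIV::'e set). 0)) at_top"
    unfolding err_def
    by (intro tendsto_sum tendsto_mult_left_zero tendsto_rabs_zero) 
  then have "\<forall>\<^sub>F t in at_top. err t < c / 2"
    using \<open>0 < c\<close> by (intro order_tendstoD) auto
  then have "\<forall>\<^sub>F t in at_top. norm (norm (X t)) \<le> C * exp (- (c / 2 * t))"
    using eventually_gt_at_top[of 0]
  proof eventually_elim
    case (elim t)
    have "norm (rest t) \<le> c / 2 * t"
      using rest_le[OF elim(2)] mult_right_mono[of "err t" "c / 2" t] elim by linarith
    then have growth: "norm (exp (rest t)) \<le> exp (c / 2 * t)"
      using norm_exp[of "rest t"] by (meson exp_le_cancel_iff order_trans)
    have "X t = endo_apply (exp (rest t)) (endo_apply (exp (t *\<^sub>R endo_of Abar)) (X 0))"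
      using solution_eq_exp[of t] elim by (simp add: split)
    then have "norm (X t) \<le> exp (c / 2 * t) * (C * exp (- (c * t)))"
      using norm_endo_apply_le[of "exp (rest t)" "endo_apply (exp (t *\<^sub>R endo_of Abar)) (X 0)"]
        mult_mono[OF growth decay[of t]] elim by simp
    also have "\<dots> = C * exp (- (c / 2 * t))"
      by (simp add: field_simps flip: exp_add)
    finally show ?case by simp
  qed
  moreover have "((\<lambda>t. C * exp (- (c / 2 * t))) \<longlongrightarrow> C * 0) at_top"
  proof (intro tendsto_mult tendsto_const filterlim_compose[OF exp_at_bot])
    show "filterlim (\<lambda>t. - (c / 2 * t)) at_bot at_top"
      unfolding filterlim_uminus_at_bot minus_minus
      by (rule filterlim_tendsto_pos_mult_at_top[OF tendsto_const _ filterlim_ident])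
        (use \<open>0 < c\<close> in simp)
  qed
  ultimately show ?thesis
    unfolding mult_zero_right by (rule Lim_null_comparison)
qed

end

section \<open>Almost sure convergence to zero\<close>

theorem theorem2p2:
  fixes M :: "'w measure"
    and F :: "real \<Rightarrow> 'w measure"
    and A :: "'e::finite \<Rightarrow> real^'d^'d"
    and Q :: "real^'e^'e"
    and r :: real
    and p :: "real^'e"
    and I :: "real \<Rightarrow> 'w \<Rightarrow> 'e"
    and X :: "real \<Rightarrow> 'w \<Rightarrow> real^'d"
  assumes "prob_space M"
    and "irreducible_generator Q"
    and "r > 0"
    and "markov_jump_process M F (r *\<^sub>R Q) I"
    and "probability_vector p" and "p v* Q = 0"
    and "X 0 \<in> borel_measurable (F 0)"
    and "integrable M (\<lambda>w. norm (X 0 w))"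
    and "\<forall>w\<in>space M. \<forall>t\<ge>0.
           ((\<lambda>s. A (I s w) *v X s w) has_integral (X t w - X 0 w)) {0..t}"
    and "\<forall>i j. A i ** A j = A j ** A i"
    and "hurwitz (\<Sum>i\<in>UNIV. p $ i *\<^sub>R A i)"
  shows "AE w in M. ((\<lambda>t. norm (X t w)) \<longlongrightarrow> 0) at_top"
proof -
  interpret finite_markov_process M F "r *\<^sub>R Q" I
    using assms(1,4) by (simp add: finite_markov_process_def finite_markov_process_axioms_def)
  show ?thesis
    using ergodic_averages[OF refl assms(3,2,5,6)] AE_space
  proof eventually_elim
    case (elim w)
    interpret commuting_switched_flow A "\<lambda>t. I t w" "\<lambda>t. X t w"
    proof
      show "jump_path (\<lambda>t. I t w)"
        using process elim(2) by (simp add: markov_jump_process_def)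
      show "(\<lambda>s. of_bool (I s w = i) :: real) integrable_on {0..t}" if "0 \<le> t" for i t
        using occupation_lebesgue(1)[OF elim(2) order_refl that, of "\<chi> j. of_bool (j = i)"] by simp
    qed (use assms elim in auto)
    show ?case
      by (rule solution_tendsto_0[OF assms(11)]) (use elim(1) in \<open>simp add: time_in_def\<close>)
  qed
qed

end
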